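(* Let $M$ be a $C^\infty$ Riemannian manifold of dimension $n\ge2$ and let $\Sigma\subset M\times\mathbb{R}$ be an $(f_s,a)$-graph, $s\in I\subset\mathbb{R}$, such that $f_s$ is isoparametric with constant mean curvature $H_s$. Assume that, for a given constant $H\in\mathbb{R}$, the diffeomorphism $a:I\to a(I)\subset\mathbb{R}$ is defined by $$a(s)=\int_{s_0}^{s}\frac{\varrho(u)}{\sqrt{1-\varrho(u)^2}}\,du,\qquad s_0\in I,\qquad ( * )$$ where $y=\varrho(s)$ is a solution of the first order linear differential equation $$y'=H_sy+H$$ satisfying $0<\varrho(s)<1$. Under these conditions, $\Sigma$ has constant mean curvature $H$. Conversely, if an $(f_s,a)$-graph $\Sigma\subset M\times\mathbb{R}$ has constant mean curvature $H$, then $f_s$ is isoparametric and the function $a(s)$ is necessarily given by $( * )$ with $\varrho=a'\Theta$, where $\Theta=1/\sqrt{1+(a')^2}$ is the angle function of $\Sigma$.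
   Context: $M\times\mathbb{R}$ carries the product metric $\langle\,,\rangle=\langle\,,\rangle_M+dt^2$; $\partial_t$ is the unit vertical field. For an oriented hypersurface with unit normal $N$, the shape operator is $AX=-\overline\nabla_XN$ (with $\overline\nabla$ the Levi-Civita connection of the ambient manifold) and the mean curvature is $\mathrm{trace}\,A$ (not normalized). $(f_s,a)$-graph: let $f:\Sigma_0^{n-1}\to M^n$ be an isometric immersion with unit normal field $\eta$ such that some neighborhood of $\Sigma_0$ (the zero section) in its normal bundle $T\Sigma_0^\perp$ contains no focal points of $f$, i.e. the normal exponential map restricted to it is a diffeomorphism onto its image. Then there is an open interval $I\ni 0$ such that, for every $p\in\Sigma_0$, $\gamma_p(s)=\exp_M(f(p),s\eta(p))$, $s\in I$, is a well defined geodesic without conjugate points, and $f_s:\Sigma_0\to M$, $f_s(p)=\gamma_p(s)$, is an immersion for all $s\in I$ (said to be parallel to $f$), with unit normal $\eta_s(p)=\gamma_p'(s)$. Given an increasing diffeomorphism $a:I\to a(I)\subset\mathbb{R}$ (that is, $a'>0$), the hypersurface $\Sigma=\{(f_s(p),a(s))\in M\times\mathbb{R}\,;\,p\in\Sigma_0,\ s\in I\}$ is called an $(f_s,a)$-graph. It is oriented by $N=\frac{-a'\eta_s+\partial_t}{\sqrt{1+(a')^2}}$, so its angle function is $\Theta=\langle N,\partial_t\rangle=1/\sqrt{1+(a')^2}$. The family of parallel hypersurfaces $f_s$, $s\in I$, is isoparametric if, for every $s\in I$, $f_s$ has constant mean curvature $H_s$ (depending only on $s$); the mean curvature $H_s$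 is taken with respect to $\eta_s$.
   Formalization: In the converse, ( * ) is proved up to a vertical translation, as a(s) − a(s_0) = the integral for every s_0 in I, since ( * ) taken literally forces a(s_0) = 0, which fails for example for a(s) = s + 100 over parallel lines in the plane. *)

theory Defs
  imports "HOL-Analysis.Analysis"
begin

section \<open>Smooth maps between Euclidean spaces\<close>

fun ck_on :: "nat \<Rightarrow> ('a::euclidean_space \<Rightarrow> 'b::real_normed_vector) \<Rightarrow> 'a set \<Rightarrow> bool" where
  "ck_on 0 f U \<longleftrightarrow> continuous_on U f"
| "ck_on (Suc k) f U \<longleftrightarrow>
     (\<forall>x\<in>U. f differentiable (at x)) \<and> (\<forall>v. ck_on k (\<lambda>x. frechet_derivative f (at x) v) U)"

text \<open>Only used for open sets, as the derivatives are taken with respect to full neighbourhoods.\<close>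

definition smooth_on :: "'a::euclidean_space set \<Rightarrow> ('a \<Rightarrow> 'b::real_normed_vector) \<Rightarrow> bool" where
  "smooth_on U f \<longleftrightarrow> open U \<and> (\<forall>k. ck_on k f U)"


section \<open>Riemannian manifolds\<close>

text \<open>
  A manifold is an indexed atlas. Its points form an open subset of the ambient type
  (the union of the chart domains); its dimension is the dimension of the model space \<open>'e\<close>.
  The field \<open>metric_at M i p\<close> is the inner product on the tangent space at \<open>p\<close>, expressed
  in the coordinate frame of chart \<open>i\<close>.
\<close>

record ('i, 'm, 'e) riemannian =
  charts :: "'i set"
  chart_dom :: "'i \<Rightarrow> 'm set"
  chart_map :: "'i \<Rightarrow> 'm \<Rightarrow> 'e"
  metric_at :: "'i \<Rightarrow> 'm \<Rightarrow> 'e \<Rightarrow> 'e \<Rightarrow> real"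

definition points :: "('i, 'm, 'e) riemannian \<Rightarrow> 'm set" where
  "points M = (\<Union>i\<in>charts M. chart_dom M i)"

definition chart_inv :: "('i, 'm, 'e) riemannian \<Rightarrow> 'i \<Rightarrow> 'e \<Rightarrow> 'm" where
  "chart_inv M i = inv_into (chart_dom M i) (chart_map M i)"

text \<open>The differential of \<open>F\<close> at \<open>p\<close>, in the chart \<open>i\<close> of the source and \<open>j\<close> of the target.\<close>

definition differential ::
  "('i, 's, 'd::euclidean_space) riemannian \<Rightarrow> ('j, 'm, 'e::euclidean_space) riemannian \<Rightarrow>
   ('s \<Rightarrow> 'm) \<Rightarrow> 'i \<Rightarrow> 'j \<Rightarrow> 's \<Rightarrow> 'd \<Rightarrow> 'e" where
  "differential S M F i j p =
     frechet_derivative (chart_map M j \<circ> F \<circ> chart_inv S i) (at (chart_map S i p))"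

definition smooth_atlas ::
  "('i, 'm::topological_space, 'e::euclidean_space) riemannian \<Rightarrow> bool" where
  "smooth_atlas M \<longleftrightarrow>
     (\<forall>i\<in>charts M. open (chart_dom M i) \<and> open (chart_map M i ` chart_dom M i) \<and>
        homeomorphism (chart_dom M i) (chart_map M i ` chart_dom M i)
          (chart_map M i) (chart_inv M i)) \<and>
     (\<forall>i\<in>charts M. \<forall>j\<in>charts M.
        smooth_on (chart_map M i ` (chart_dom M i \<inter> chart_dom M j))
          (chart_map M j \<circ> chart_inv M i))"

text \<open>
  The condition involving \<open>differential M M (\<lambda>x. x) i j p\<close>, the Jacobian of the coordinate change,
  says that the local expressions define one tensor.
\<close>

definition riemannian_manifold ::
  "('i, 'm::{t2_space, second_countable_topology}, 'e::euclidean_space) riemannian \<Rightarrow> bool" where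
  "riemannian_manifold M \<longleftrightarrow>
     smooth_atlas M \<and>
     (\<forall>i\<in>charts M. \<forall>p\<in>chart_dom M i.
        bilinear (metric_at M i p) \<and>
        (\<forall>u v. metric_at M i p u v = metric_at M i p v u) \<and>
        (\<forall>u. u \<noteq> 0 \<longrightarrow> metric_at M i p u u > 0)) \<and>
     (\<forall>i\<in>charts M. \<forall>u v.
        smooth_on (chart_map M i ` chart_dom M i) (\<lambda>x. metric_at M i (chart_inv M i x) u v)) \<and>
     (\<forall>i\<in>charts M. \<forall>j\<in>charts M. \<forall>p\<in>chart_dom M i \<inter> chart_dom M j. \<forall>u v.
        metric_at M j p (differential M M (\<lambda>x. x) i j p u) (differential M M (\<lambda>x. x) i j p v)
          = metric_at M i p u v)"

definition real_line :: "(unit, real, real) riemannian" where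
  "real_line = \<lparr>charts = {()}, chart_dom = (\<lambda>_. UNIV), chart_map = (\<lambda>_ t. t),
     metric_at = (\<lambda>_ _ u v. u * v)\<rparr>"

definition riemannian_product ::
  "('i, 'm, 'e) riemannian \<Rightarrow> ('j, 'n, 'f) riemannian \<Rightarrow> ('i \<times> 'j, 'm \<times> 'n, 'e \<times> 'f) riemannian"
  where
  "riemannian_product M N =
     \<lparr>charts = charts M \<times> charts N,
      chart_dom = (\<lambda>(i, j). chart_dom M i \<times> chart_dom N j),
      chart_map = (\<lambda>(i, j). map_prod (chart_map M i) (chart_map N j)),
      metric_at = (\<lambda>(i, j) (p, q) (u, u') (v, v'). metric_at M i p u v + metric_at N j q u' v')\<rparr>"

definition smooth_map ::
  "('i, 's::topological_space, 'd::euclidean_space) riemannian \<Rightarrow>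
   ('j, 'm::topological_space, 'e::euclidean_space) riemannian \<Rightarrow>
   's set \<Rightarrow> ('s \<Rightarrow> 'm) \<Rightarrow> bool" where
  "smooth_map S M W F \<longleftrightarrow>
     open W \<and> W \<subseteq> points S \<and> F ` W \<subseteq> points M \<and> continuous_on W F \<and>
     (\<forall>i\<in>charts S. \<forall>j\<in>charts M.
        smooth_on (chart_map S i ` (W \<inter> chart_dom S i \<inter> F -` chart_dom M j))
          (chart_map M j \<circ> F \<circ> chart_inv S i))"

definition diffeo_onto_image ::
  "('i, 's::topological_space, 'd::euclidean_space) riemannian \<Rightarrow>
   ('j, 'm::topological_space, 'e::euclidean_space) riemannian \<Rightarrow>
   's set \<Rightarrow> ('s \<Rightarrow> 'm) \<Rightarrow> bool" where
  "diffeo_onto_image S M W F \<longleftrightarrow>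
     smooth_map S M W F \<and> inj_on F W \<and> smooth_map M S (F ` W) (inv_into W F)"

definition immersion ::
  "('i, 's::topological_space, 'd::euclidean_space) riemannian \<Rightarrow>
   ('j, 'm::topological_space, 'e::euclidean_space) riemannian \<Rightarrow>
   's set \<Rightarrow> ('s \<Rightarrow> 'm) \<Rightarrow> bool" where
  "immersion S M W F \<longleftrightarrow>
     smooth_map S M W F \<and>
     (\<forall>p\<in>W. \<forall>i\<in>charts S. \<forall>j\<in>charts M. p \<in> chart_dom S i \<longrightarrow> F p \<in> chart_dom M j \<longrightarrow>
        inj (differential S M F i j p))"

definition isometric_immersion ::
  "('i, 's::topological_space, 'd::euclidean_space) riemannian \<Rightarrow>
   ('j, 'm::topological_space, 'e::euclidean_space) riemannian \<Rightarrow>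
   ('s \<Rightarrow> 'm) \<Rightarrow> bool" where
  "isometric_immersion S M f \<longleftrightarrow>
     immersion S M (points S) f \<and>
     (\<forall>p\<in>points S. \<forall>i\<in>charts S. \<forall>j\<in>charts M. p \<in> chart_dom S i \<longrightarrow> f p \<in> chart_dom M j \<longrightarrow>
        (\<forall>u v. metric_at M j (f p) (differential S M f i j p u) (differential S M f i j p v)
           = metric_at S i p u v))"


section \<open>Vector fields along maps and the Levi-Civita connection\<close>

text \<open>
  A tangent vector is the family of its coordinate vectors in all charts; only the
  components in charts around its base point are meaningful.
\<close>

definition tangent_vector ::
  "('i, 'm, 'e::euclidean_space) riemannian \<Rightarrow> 'm \<Rightarrow> ('i \<Rightarrow> 'e) \<Rightarrow> bool" where
  "tangent_vector M p V \<longleftrightarrow>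
     (\<forall>i\<in>charts M. \<forall>j\<in>charts M. p \<in> chart_dom M i \<inter> chart_dom M j \<longrightarrow>
        V j = differential M M (\<lambda>x. x) i j p (V i))"

definition vector_field_along ::
  "('i, 's::topological_space, 'd::euclidean_space) riemannian \<Rightarrow>
   ('j, 'm::topological_space, 'e::euclidean_space) riemannian \<Rightarrow>
   's set \<Rightarrow> ('s \<Rightarrow> 'm) \<Rightarrow> ('s \<Rightarrow> 'j \<Rightarrow> 'e) \<Rightarrow> bool" where
  "vector_field_along S M W F V \<longleftrightarrow>
     (\<forall>p\<in>W. tangent_vector M (F p) (V p)) \<and>
     (\<forall>i\<in>charts S. \<forall>j\<in>charts M.
        smooth_on (chart_map S i ` (W \<inter> chart_dom S i \<inter> F -` chart_dom M j))
          (\<lambda>x. V (chart_inv S i x) j))"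

definition metric_derivative ::
  "('i, 'm, 'e::euclidean_space) riemannian \<Rightarrow> 'i \<Rightarrow> 'm \<Rightarrow> 'e \<Rightarrow> 'e \<Rightarrow> 'e \<Rightarrow> real" where
  "metric_derivative M i p w u v =
     frechet_derivative (\<lambda>x. metric_at M i (chart_inv M i x) u v) (at (chart_map M i p)) w"

text \<open>
  The Christoffel symbols \<open>\<Gamma>(u, v) = \<nabla>\<^sub>u v\<close>, for \<open>u\<close>, \<open>v\<close> constant in the coordinates of chart
  \<open>i\<close>: the Levi-Civita connection is the one that is torsion-free (\<open>\<Gamma>\<close> symmetric) and metric.
  At a point these conditions are algebraic in \<open>\<Gamma>\<close> and have exactly one solution.
\<close>

definition christoffel ::
  "('i, 'm, 'e::euclidean_space) riemannian \<Rightarrow> 'i \<Rightarrow> 'm \<Rightarrow> 'e \<Rightarrow> 'e \<Rightarrow> 'e" where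
  "christoffel M i p =
     (THE \<Gamma>. bilinear \<Gamma> \<and> (\<forall>u v. \<Gamma> u v = \<Gamma> v u) \<and>
        (\<forall>w u v. metric_derivative M i p w u v
           = metric_at M i p (\<Gamma> w u) v + metric_at M i p u (\<Gamma> w v)))"

text \<open>
  \<open>\<nabla>\<^sub>u V\<close> for a field \<open>V\<close> along \<open>F\<close> and the tangent vector at \<open>p\<close> with
  coordinates \<open>u\<close> in the chart \<open>i\<close> of the source, expressed in the chart \<open>j\<close> of the target.
\<close>

definition covariant_derivative ::
  "('i, 's, 'd::euclidean_space) riemannian \<Rightarrow> ('j, 'm, 'e::euclidean_space) riemannian \<Rightarrow>
   ('s \<Rightarrow> 'm) \<Rightarrow> ('s \<Rightarrow> 'j \<Rightarrow> 'e) \<Rightarrow> 'i \<Rightarrow> 'j \<Rightarrow> 's \<Rightarrow> 'd \<Rightarrow> 'e" where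
  "covariant_derivative S M F V i j p u =
     frechet_derivative (\<lambda>x. V (chart_inv S i x) j) (at (chart_map S i p)) u
     + christoffel M j (F p) (differential S M F i j p u) (V p j)"


section \<open>Oriented hypersurfaces and mean curvature\<close>

definition oriented_hypersurface ::
  "('i, 's::topological_space, 'd::euclidean_space) riemannian \<Rightarrow>
   ('j, 'm::topological_space, 'e::euclidean_space) riemannian \<Rightarrow>
   's set \<Rightarrow> ('s \<Rightarrow> 'm) \<Rightarrow> ('s \<Rightarrow> 'j \<Rightarrow> 'e) \<Rightarrow> bool" where
  "oriented_hypersurface S M W F N \<longleftrightarrow>
     DIM('d) + 1 = DIM('e) \<and> immersion S M W F \<and> vector_field_along S M W F N \<and>
     (\<forall>p\<in>W. \<forall>i\<in>charts S. \<forall>j\<in>charts M. p \<in> chart_dom S i \<longrightarrow> F p \<in> chart_dom M j \<longrightarrow>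
        metric_at M j (F p) (N p j) (N p j) = 1 \<and>
        (\<forall>u. metric_at M j (F p) (differential S M F i j p u) (N p j) = 0))"

text \<open>The shape operator \<open>A u = - \<nabla>\<^sub>u N\<close>, as an endomorphism of the tangent space of the source.\<close>

definition shape_operator ::
  "('i, 's, 'd::euclidean_space) riemannian \<Rightarrow> ('j, 'm, 'e::euclidean_space) riemannian \<Rightarrow>
   ('s \<Rightarrow> 'm) \<Rightarrow> ('s \<Rightarrow> 'j \<Rightarrow> 'e) \<Rightarrow> 'i \<Rightarrow> 'j \<Rightarrow> 's \<Rightarrow> 'd \<Rightarrow> 'd" where
  "shape_operator S M F N i j p u =
     (THE w. differential S M F i j p w = - covariant_derivative S M F N i j p u)"

definition endo_trace :: "('d::euclidean_space \<Rightarrow> 'd) \<Rightarrow> real" where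
  "endo_trace A = (\<Sum>b\<in>Basis. A b \<bullet> b)"

text \<open>The trace does not depend on the charts \<open>i\<close>, \<open>j\<close>, so all charts are asked to give the value \<open>H\<close>.\<close>

definition constant_mean_curvature ::
  "('i, 's::topological_space, 'd::euclidean_space) riemannian \<Rightarrow>
   ('j, 'm::topological_space, 'e::euclidean_space) riemannian \<Rightarrow>
   's set \<Rightarrow> ('s \<Rightarrow> 'm) \<Rightarrow> ('s \<Rightarrow> 'j \<Rightarrow> 'e) \<Rightarrow> real \<Rightarrow> bool" where
  "constant_mean_curvature S M W F N H \<longleftrightarrow>
     oriented_hypersurface S M W F N \<and>
     (\<forall>p\<in>W. \<forall>i\<in>charts S. \<forall>j\<in>charts M. p \<in> chart_dom S i \<longrightarrow> F p \<in> chart_dom M j \<longrightarrow>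
        endo_trace (shape_operator S M F N i j p) = H)"


section \<open>Geodesics, exponential map, conjugate points\<close>

definition velocity ::
  "('j, 'm, 'e::euclidean_space) riemannian \<Rightarrow> (real \<Rightarrow> 'm) \<Rightarrow> real \<Rightarrow> 'j \<Rightarrow> 'e" where
  "velocity M \<gamma> t j = differential real_line M \<gamma> () j t 1"

definition covariant_dt ::
  "('j, 'm, 'e::euclidean_space) riemannian \<Rightarrow> (real \<Rightarrow> 'm) \<Rightarrow> (real \<Rightarrow> 'j \<Rightarrow> 'e) \<Rightarrow>
   real \<Rightarrow> 'j \<Rightarrow> 'e" where
  "covariant_dt M \<gamma> V t j = covariant_derivative real_line M \<gamma> V () j t 1"

definition geodesic ::
  "('j, 'm::topological_space, 'e::euclidean_space) riemannian \<Rightarrow> real set \<Rightarrow> (real \<Rightarrow> 'm) \<Rightarrow> bool"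
  where
  "geodesic M J \<gamma> \<longleftrightarrow>
     is_interval J \<and> smooth_map real_line M J \<gamma> \<and>
     (\<forall>t\<in>J. \<forall>j\<in>charts M. \<gamma> t \<in> chart_dom M j \<longrightarrow> covariant_dt M \<gamma> (velocity M \<gamma>) t j = 0)"

definition geodesic_from ::
  "('j, 'm::topological_space, 'e::euclidean_space) riemannian \<Rightarrow> real set \<Rightarrow> 'm \<Rightarrow> ('j \<Rightarrow> 'e) \<Rightarrow>
   (real \<Rightarrow> 'm) \<Rightarrow> bool" where
  "geodesic_from M J q V \<gamma> \<longleftrightarrow>
     geodesic M J \<gamma> \<and> 0 \<in> J \<and> \<gamma> 0 = q \<and>
     (\<forall>j\<in>charts M. q \<in> chart_dom M j \<longrightarrow> velocity M \<gamma> 0 j = V j)"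

definition exp_defined ::
  "('j, 'm::topological_space, 'e::euclidean_space) riemannian \<Rightarrow> 'm \<Rightarrow> ('j \<Rightarrow> 'e) \<Rightarrow> bool" where
  "exp_defined M q V \<longleftrightarrow> (\<exists>J \<gamma>. geodesic_from M J q V \<gamma> \<and> 1 \<in> J)"

definition exp_map ::
  "('j, 'm::topological_space, 'e::euclidean_space) riemannian \<Rightarrow> 'm \<Rightarrow> ('j \<Rightarrow> 'e) \<Rightarrow> 'm" where
  "exp_map M q V = (THE x. \<exists>J \<gamma>. geodesic_from M J q V \<gamma> \<and> 1 \<in> J \<and> x = \<gamma> 1)"

text \<open>The sign convention is \<open>R(u, v)w = \<nabla>\<^sub>u \<nabla>\<^sub>v w - \<nabla>\<^sub>v \<nabla>\<^sub>u w - \<nabla>\<^bsub>[u, v]\<^esub> w\<close>.\<close>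

definition curvature_tensor ::
  "('j, 'm, 'e::euclidean_space) riemannian \<Rightarrow> 'j \<Rightarrow> 'm \<Rightarrow> 'e \<Rightarrow> 'e \<Rightarrow> 'e \<Rightarrow> 'e" where
  "curvature_tensor M j p u v w =
     frechet_derivative (\<lambda>x. christoffel M j (chart_inv M j x) v w) (at (chart_map M j p)) u
     - frechet_derivative (\<lambda>x. christoffel M j (chart_inv M j x) u w) (at (chart_map M j p)) v
     + christoffel M j p u (christoffel M j p v w)
     - christoffel M j p v (christoffel M j p u w)"

definition jacobi_field ::
  "('j, 'm::topological_space, 'e::euclidean_space) riemannian \<Rightarrow> real set \<Rightarrow> (real \<Rightarrow> 'm) \<Rightarrow>
   (real \<Rightarrow> 'j \<Rightarrow> 'e) \<Rightarrow> bool" where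
  "jacobi_field M J \<gamma> Y \<longleftrightarrow>
     vector_field_along real_line M J \<gamma> Y \<and>
     (\<forall>t\<in>J. \<forall>j\<in>charts M. \<gamma> t \<in> chart_dom M j \<longrightarrow>
        covariant_dt M \<gamma> (covariant_dt M \<gamma> Y) t j
        + curvature_tensor M j (\<gamma> t) (Y t j) (velocity M \<gamma> t j) (velocity M \<gamma> t j) = 0)"

definition vanishes_at ::
  "('j, 'm, 'e::euclidean_space) riemannian \<Rightarrow> (real \<Rightarrow> 'm) \<Rightarrow> (real \<Rightarrow> 'j \<Rightarrow> 'e) \<Rightarrow> real \<Rightarrow> bool"
  where
  "vanishes_at M \<gamma> Y t \<longleftrightarrow> (\<forall>j\<in>charts M. \<gamma> t \<in> chart_dom M j \<longrightarrow> Y t j = 0)"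

definition without_conjugate_points ::
  "('j, 'm::topological_space, 'e::euclidean_space) riemannian \<Rightarrow> real set \<Rightarrow> (real \<Rightarrow> 'm) \<Rightarrow> bool"
  where
  "without_conjugate_points M J \<gamma> \<longleftrightarrow>
     (\<forall>Y. jacobi_field M J \<gamma> Y \<longrightarrow>
        (\<exists>t1\<in>J. \<exists>t2\<in>J. t1 \<noteq> t2 \<and> vanishes_at M \<gamma> Y t1 \<and> vanishes_at M \<gamma> Y t2) \<longrightarrow>
        (\<forall>t\<in>J. vanishes_at M \<gamma> Y t))"


section \<open>Parallel hypersurfaces and the graphs built from them\<close>

definition parallel_map ::
  "('j, 'm::topological_space, 'e::euclidean_space) riemannian \<Rightarrow> ('s \<Rightarrow> 'm) \<Rightarrow>
   ('s \<Rightarrow> 'j \<Rightarrow> 'e) \<Rightarrow> real \<Rightarrow> 's \<Rightarrow> 'm" where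
  "parallel_map M f \<eta> s p = exp_map M (f p) (\<lambda>j. s *\<^sub>R \<eta> p j)"

definition parallel_normal ::
  "('j, 'm::topological_space, 'e::euclidean_space) riemannian \<Rightarrow> ('s \<Rightarrow> 'm) \<Rightarrow>
   ('s \<Rightarrow> 'j \<Rightarrow> 'e) \<Rightarrow> real \<Rightarrow> 's \<Rightarrow> 'j \<Rightarrow> 'e" where
  "parallel_normal M f \<eta> s p = velocity M (\<lambda>t. parallel_map M f \<eta> t p) s"

text \<open>
  The normal bundle of \<open>f\<close> is identified with \<open>points S \<times> UNIV\<close> by \<open>(p, s) \<mapsto> s \<eta>(p)\<close>.
\<close>

definition focal_free_neighbourhood ::
  "('i, 's::topological_space, 'd::euclidean_space) riemannian \<Rightarrow>
   ('j, 'm::topological_space, 'e::euclidean_space) riemannian \<Rightarrow>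
   ('s \<Rightarrow> 'm) \<Rightarrow> ('s \<Rightarrow> 'j \<Rightarrow> 'e) \<Rightarrow> bool" where
  "focal_free_neighbourhood S M f \<eta> \<longleftrightarrow>
     (\<exists>W. open W \<and> points S \<times> {0} \<subseteq> W \<and> W \<subseteq> points S \<times> UNIV \<and>
        (\<forall>(p, s)\<in>W. exp_defined M (f p) (\<lambda>j. s *\<^sub>R \<eta> p j)) \<and>
        diffeo_onto_image (riemannian_product S real_line) M W (\<lambda>(p, s). parallel_map M f \<eta> s p))"

text \<open>
  In the definition below, joint smoothness in \<open>(p, s)\<close> is no extra restriction: it is the smooth
  dependence of geodesics on their initial data.
\<close>

definition parallel_family ::
  "('i, 's::{t2_space, second_countable_topology}, 'd::euclidean_space) riemannian \<Rightarrow>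
   ('j, 'm::{t2_space, second_countable_topology}, 'e::euclidean_space) riemannian \<Rightarrow>
   ('s \<Rightarrow> 'm) \<Rightarrow> ('s \<Rightarrow> 'j \<Rightarrow> 'e) \<Rightarrow> real set \<Rightarrow> bool" where
  "parallel_family S M f \<eta> I \<longleftrightarrow>
     riemannian_manifold S \<and> riemannian_manifold M \<and>
     isometric_immersion S M f \<and> oriented_hypersurface S M (points S) f \<eta> \<and>
     focal_free_neighbourhood S M f \<eta> \<and>
     open I \<and> is_interval I \<and> 0 \<in> I \<and>
     (\<forall>p\<in>points S.
        geodesic_from M I (f p) (\<eta> p) (\<lambda>s. parallel_map M f \<eta> s p) \<and>
        without_conjugate_points M I (\<lambda>s. parallel_map M f \<eta> s p)) \<and>
     smooth_map (riemannian_product S real_line) M (points S \<times> I) (\<lambda>(p, s). parallel_map M f \<eta> s p) \<and>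
     (\<forall>s\<in>I. immersion S M (points S) (parallel_map M f \<eta> s))"

definition isoparametric ::
  "('i, 's::topological_space, 'd::euclidean_space) riemannian \<Rightarrow>
   ('j, 'm::topological_space, 'e::euclidean_space) riemannian \<Rightarrow>
   ('s \<Rightarrow> 'm) \<Rightarrow> ('s \<Rightarrow> 'j \<Rightarrow> 'e) \<Rightarrow> real set \<Rightarrow> (real \<Rightarrow> real) \<Rightarrow> bool" where
  "isoparametric S M f \<eta> I Hs \<longleftrightarrow>
     (\<forall>s\<in>I. constant_mean_curvature S M (points S)
        (parallel_map M f \<eta> s) (parallel_normal M f \<eta> s) (Hs s))"

text \<open>The data of an \<open>(f\<^sub>s, a)\<close>-graph; the hypersurface itself is the immersion \<open>graph_map\<close> below.\<close>

definition fs_a_graph ::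
  "('i, 's::{t2_space, second_countable_topology}, 'd::euclidean_space) riemannian \<Rightarrow>
   ('j, 'm::{t2_space, second_countable_topology}, 'e::euclidean_space) riemannian \<Rightarrow>
   ('s \<Rightarrow> 'm) \<Rightarrow> ('s \<Rightarrow> 'j \<Rightarrow> 'e) \<Rightarrow> real set \<Rightarrow> (real \<Rightarrow> real) \<Rightarrow> bool" where
  "fs_a_graph S M f \<eta> I a \<longleftrightarrow>
     parallel_family S M f \<eta> I \<and> smooth_on I a \<and> (\<forall>s\<in>I. deriv a s > 0)"

definition graph_map ::
  "('j, 'm::topological_space, 'e::euclidean_space) riemannian \<Rightarrow> ('s \<Rightarrow> 'm) \<Rightarrow>
   ('s \<Rightarrow> 'j \<Rightarrow> 'e) \<Rightarrow> (real \<Rightarrow> real) \<Rightarrow> 's \<times> real \<Rightarrow> 'm \<times> real" where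
  "graph_map M f \<eta> a = (\<lambda>(p, s). (parallel_map M f \<eta> s p, a s))"

definition graph_angle :: "(real \<Rightarrow> real) \<Rightarrow> real \<Rightarrow> real" where
  "graph_angle a s = 1 / sqrt (1 + (deriv a s)\<^sup>2)"

definition graph_normal ::
  "('j, 'm::topological_space, 'e::euclidean_space) riemannian \<Rightarrow> ('s \<Rightarrow> 'm) \<Rightarrow>
   ('s \<Rightarrow> 'j \<Rightarrow> 'e) \<Rightarrow> (real \<Rightarrow> real) \<Rightarrow> 's \<times> real \<Rightarrow> 'j \<times> unit \<Rightarrow> 'e \<times> real" where
  "graph_normal M f \<eta> a =
     (\<lambda>(p, s) (j, _). (1 / sqrt (1 + (deriv a s)\<^sup>2)) *\<^sub>R
        (- deriv a s *\<^sub>R parallel_normal M f \<eta> s p j, 1))"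

definition graph_has_constant_mean_curvature ::
  "('i, 's::topological_space, 'd::euclidean_space) riemannian \<Rightarrow>
   ('j, 'm::topological_space, 'e::euclidean_space) riemannian \<Rightarrow>
   ('s \<Rightarrow> 'm) \<Rightarrow> ('s \<Rightarrow> 'j \<Rightarrow> 'e) \<Rightarrow> real set \<Rightarrow> (real \<Rightarrow> real) \<Rightarrow> real \<Rightarrow> bool" where
  "graph_has_constant_mean_curvature S M f \<eta> I a H \<longleftrightarrow>
     constant_mean_curvature (riemannian_product S real_line) (riemannian_product M real_line)
       (points S \<times> I) (graph_map M f \<eta> a) (graph_normal M f \<eta> a) H"

definition profile_solution :: "real set \<Rightarrow> (real \<Rightarrow> real) \<Rightarrow> real \<Rightarrow> (real \<Rightarrow> real) \<Rightarrow> bool" where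
  "profile_solution I Hs H \<rho> \<longleftrightarrow>
     (\<forall>s\<in>I. (\<rho> has_real_derivative Hs s * \<rho> s + H) (at s) \<and> 0 < \<rho> s \<and> \<rho> s < 1)"

end

theory Submission
  imports Defs
begin

text \<open>
  Put \<open>\<rho> = a' \<Theta>\<close>. The geodesic equation \<open>\<nabla>\<^bsub>\<partial>s\<^esub> \<eta>\<^sub>s = 0\<close> makes the graph direction \<open>(\<eta>\<^sub>s, a')\<close> principal
  with curvature \<open>\<rho>'\<close>, while on directions tangent to \<open>f\<^sub>s\<close> the shape operator of the graph is
  \<open>-\<rho>\<close> times that of \<open>f\<^sub>s\<close>. Hence the mean curvature of the graph at \<open>(p, s)\<close> is \<open>\<rho>' - \<rho> H\<^sub>s(p)\<close>, and
  it equals \<open>H\<close> everywhere iff \<open>H\<^sub>s\<close> depends only on \<open>s\<close> and \<open>\<rho>' = H\<^sub>s \<rho> + H\<close>. Finally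
  \<open>\<rho> = a' \<Theta>\<close> is equivalent to \<open>a' = \<rho> / \<surd>(1 - \<rho>\<^sup>2)\<close>, so \<open>a\<close> is an integral.
\<close>

section \<open>Smooth maps\<close>

text \<open>The choice of \<rho> is what makes the graph direction principal. The normal is N =
  (-\<rho> \<eta>_s, \<Theta>), and \<Theta>^2 + \<rho>^2 = 1 forces \<Theta>' = -a' \<rho>'. Its
  covariant derivative in the s direction is therefore -\<rho>' (\<eta>_s, a'), a multiple of the
  graph direction itself. Since \<rho> and \<Theta> depend on s alone, only \<eta>_s is
  differentiated in slice directions. The shape operator is thus block diagonal in a product chart,
  and its trace can be read off the coordinate basis without an orthonormal frame. Two obstacles
  shape the proof. Christoffel symbols and shape operators are definite descriptions, so existence
  and uniqueness come before any computation with them: the Koszul formula settles the first,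
  tangency of the derivative of N the second. Moreover, \<open>parallel_family\<close> asks the maps
  f_s to be immersions but does not state that \<eta>_s is their unit normal. The direct implication
  gets this from \<open>isoparametric\<close>; the converse has to extract it from the normal of the
  graph.\<close>

lemma ck_on_cong:
  assumes "ck_on k f U" "open U" "\<And>x. x \<in> U \<Longrightarrow> f x = g x"
  shows "ck_on k g U"
  using assms(1,3)
proof (induction k arbitrary: f g)
  case 0
  then show ?case by (metis ck_on.simps(1) continuous_on_cong)
next
  case (Suc k)
  \<comment> \<open>Since \<open>U\<close> is open, equality on \<open>U\<close> is equality near
    each of its points, so it passes to the derivatives and the induction can continue with
    them.\<close>
  have d: "(g has_derivative frechet_derivative f (at x)) (at x)" if "x \<in> U" for x
    using Suc.prems that \<open>open U\<close>
    by (intro has_derivative_transform_within_open[of f _ x UNIV U g])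
       (auto simp: frechet_derivative_works)
  have "ck_on k (\<lambda>x. frechet_derivative g (at x) v) U" for v
  proof (rule Suc.IH)
    show "ck_on k (\<lambda>x. frechet_derivative f (at x) v) U" using Suc.prems(1) by simp
    show "frechet_derivative f (at x) v = frechet_derivative g (at x) v" if "x \<in> U" for x
      using frechet_derivative_at[OF d[OF that]] by (rule fun_cong)
  qed
  moreover have "g differentiable (at x)" if "x \<in> U" for x
    using d[OF that] by (rule differentiableI)
  ultimately show ?case by simp
qed

lemma ck_on_SucI:
  assumes "\<And>x. x \<in> U \<Longrightarrow> (f has_derivative f' x) (at x)" "open U"
    and "\<And>v. ck_on k (\<lambda>x. f' x v) U"
  shows "ck_on (Suc k) f U"
proof -
  have "ck_on k (\<lambda>x. frechet_derivative f (at x) v) U" for v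
    by (rule ck_on_cong[OF assms(3)[of v] assms(2)]) (simp add: frechet_derivative_at[OF assms(1)])
  moreover have "f differentiable (at x)" if "x \<in> U" for x
    using assms(1)[OF that] by (rule differentiableI)
  ultimately show ?thesis by simp
qed

lemma ck_on_SucD:
  assumes "ck_on (Suc k) f U"
  shows "x \<in> U \<Longrightarrow> (f has_derivative frechet_derivative f (at x)) (at x)"
    and "ck_on k (\<lambda>x. frechet_derivative f (at x) v) U"
  using assms by (simp_all add: frechet_derivative_works[symmetric])

lemma ck_on_Suc_imp: "ck_on (Suc k) f U \<Longrightarrow> ck_on k f U"
proof (induction k arbitrary: f)
  case 0
  then show ?case
    by (auto intro!: continuous_at_imp_continuous_on differentiable_imp_continuous_within)
next
  case (Suc k)
  have "ck_on k (\<lambda>x. frechet_derivative f (at x) v) U" for v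
    by (rule Suc.IH) (use Suc.prems in simp)
  with Suc.prems show ?case by simp
qed

lemma ck_on_const: "ck_on k (\<lambda>x. c) U"
  by (induction k arbitrary: c) auto

lemma ck_on_bounded_linear:
  assumes "bounded_linear h" "open U" "ck_on k f U"
  shows "ck_on k (\<lambda>x. h (f x)) U"
  using assms(3)
proof (induction k arbitrary: f)
  case 0
  then show ?case using assms(1) by (auto intro: bounded_linear.continuous_on)
next
  case (Suc k)
  show ?case
    by (rule ck_on_SucI[OF bounded_linear.has_derivative[OF assms(1) ck_on_SucD(1)[OF Suc.prems]]
          \<open>open U\<close>]) (auto intro: Suc.IH ck_on_SucD(2)[OF Suc.prems])
qed

lemma ck_on_id: "open U \<Longrightarrow> ck_on k (\<lambda>x. x) U"
proof (cases k)
  case (Suc m)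
  assume "open U"
  then show ?thesis unfolding Suc
    by (intro ck_on_SucI[where f' = "\<lambda>_ v. v"]) (auto intro: ck_on_const)
qed auto

lemma ck_on_add:
  assumes "open U" "ck_on k f U" "ck_on k g U"
  shows "ck_on k (\<lambda>x. f x + g x) U"
  using assms(2,3)
proof (induction k arbitrary: f g)
  case (Suc k)
  show ?case
    by (rule ck_on_SucI[OF has_derivative_add[OF ck_on_SucD(1)[OF Suc.prems(1)]
          ck_on_SucD(1)[OF Suc.prems(2)]] \<open>open U\<close>])
       (auto intro: Suc.IH ck_on_SucD(2)[OF Suc.prems(1)] ck_on_SucD(2)[OF Suc.prems(2)])
qed (auto intro!: continuous_intros)

lemma ck_on_sum:
  assumes "open U" "\<And>b. b \<in> B \<Longrightarrow> ck_on k (f b) U"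
  shows "ck_on k (\<lambda>x. \<Sum>b\<in>B. f b x) U"
  using assms(2)
  by (induction B rule: infinite_finite_induct) (auto intro!: ck_on_const ck_on_add[OF \<open>open U\<close>])

lemma ck_on_scaleR:
  fixes f :: "'a::euclidean_space \<Rightarrow> real"
  assumes "open U" "ck_on k f U" "ck_on k g U"
  shows "ck_on k (\<lambda>x. f x *\<^sub>R g x) U"
  using assms(2,3)
proof (induction k arbitrary: f g)
  case (Suc k)
  show ?case
    by (rule ck_on_SucI[OF has_derivative_scaleR[OF ck_on_SucD(1)[OF Suc.prems(1)]
          ck_on_SucD(1)[OF Suc.prems(2)]] \<open>open U\<close>])
       (simp_all add: ck_on_add[OF \<open>open U\<close>] Suc.IH ck_on_Suc_imp[OF Suc.prems(1)]
          ck_on_Suc_imp[OF Suc.prems(2)] ck_on_SucD(2)[OF Suc.prems(1)] ck_on_SucD(2)[OF Suc.prems(2)])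
qed (auto intro!: continuous_intros)

lemma ck_on_Pair:
  assumes "open U" "ck_on k f U" "ck_on k g U"
  shows "ck_on k (\<lambda>x. (f x, g x)) U"
proof -
  have "ck_on k (\<lambda>x. (f x, 0) + (0, g x)) U"
    using assms by (intro ck_on_add ck_on_bounded_linear[of "\<lambda>y. (y, 0)"]
        ck_on_bounded_linear[of "\<lambda>y. (0, y)"] bounded_linear_intros)
  then show ?thesis by simp
qed

lemma ck_on_compose:
  fixes f :: "'a::euclidean_space \<Rightarrow> 'b::euclidean_space" and g :: "'b \<Rightarrow> 'c::real_normed_vector"
  assumes "open U" "ck_on k f U" "ck_on k g V" "f ` U \<subseteq> V"
  shows "ck_on k (\<lambda>x. g (f x)) U"
  using assms(2,3)
proof (induction k arbitrary: g)
  case 0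
  then show ?case using assms(4) by (auto intro: continuous_on_compose2)
next
  case (Suc k)
  let ?D = "\<lambda>x. frechet_derivative f (at x)" and ?E = "\<lambda>y. frechet_derivative g (at y)"
  have E: "(g has_derivative ?E (f x)) (at (f x))" if "x \<in> U" for x
    using Suc.prems(2) ck_on_SucD(1) assms(4) that by blast
  have D: "((\<lambda>x. g (f x)) has_derivative (\<lambda>v. ?E (f x) (?D x v))) (at x)" if "x \<in> U" for x
    using has_derivative_compose[OF ck_on_SucD(1)[OF Suc.prems(1) that], of g] E[OF that] by blast
  \<comment> \<open>The direction \<open>?D x v\<close> varies with x, while \<open>ck_on\<close>
    controls derivatives of g in fixed directions only. Expanding it in the basis leaves fixed
    directions b; the induction hypothesis then applies to the derivative of g in direction b, which
    is why g is generalised.\<close>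
  have "ck_on k (\<lambda>x. ?E (f x) (?D x v)) U" for v
  proof (rule ck_on_cong[OF _ \<open>open U\<close>])
    show "ck_on k (\<lambda>x. \<Sum>b\<in>Basis. (?D x v \<bullet> b) *\<^sub>R ?E (f x) b) U"
      by (intro ck_on_sum[OF \<open>open U\<close>] ck_on_scaleR[OF \<open>open U\<close>] Suc.IH
          ck_on_bounded_linear[OF bounded_linear_inner_left \<open>open U\<close>] ck_on_SucD(2)[OF Suc.prems(1)]
          ck_on_SucD(2)[OF Suc.prems(2)] ck_on_Suc_imp[OF Suc.prems(1)])
    show "(\<Sum>b\<in>Basis. (?D x v \<bullet> b) *\<^sub>R ?E (f x) b) = ?E (f x) (?D x v)" if "x \<in> U" for x
    proof -
      have "linear (?E (f x))" using E[OF that] has_derivative_linear by blast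
      then have "?E (f x) (\<Sum>b\<in>Basis. (?D x v \<bullet> b) *\<^sub>R b) = (\<Sum>b\<in>Basis. (?D x v \<bullet> b) *\<^sub>R ?E (f x) b)"
        by (simp add: linear_sum linear_cmul)
      then show ?thesis by (simp add: euclidean_representation)
    qed
  qed
  then show ?case by (intro ck_on_SucI[OF D \<open>open U\<close>])
qed

text \<open>Each derivative lowers the exponent by one, so the induction needs all exponents at
  once. The case needed later is -1/2, for the angle function.\<close>

lemma ck_on_powr: "ck_on k (\<lambda>x::real. x powr c) {0<..}"
proof (induction k arbitrary: c)
  case (Suc k)
  have "((\<lambda>x. x powr c) has_derivative (\<lambda>v. v *\<^sub>R (c * x powr (c - 1)))) (at x)" if "x \<in> {0<..}" for x :: real
    using has_real_derivative_powr[of x c] that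
    by (auto simp: has_field_derivative_def mult.commute[of _ "c * x powr (c - 1)"])
  then show ?case
    by (rule ck_on_SucI) (auto intro!: Suc.IH
       ck_on_bounded_linear[OF bounded_linear_scaleR_right] ck_on_bounded_linear[OF bounded_linear_mult_right])
qed (auto intro!: continuous_intros)

lemma ck_on_deriv:
  fixes a :: "real \<Rightarrow> real"
  assumes "open U" "ck_on (Suc k) a U"
  shows "ck_on k (deriv a) U"
proof (rule ck_on_cong[OF ck_on_SucD(2)[OF assms(2), of 1] \<open>open U\<close>])
  fix x assume "x \<in> U"
  then have "(a has_real_derivative deriv a x) (at x)"
    using assms(2) by (simp add: DERIV_deriv_iff_real_differentiable)
  then show "frechet_derivative a (at x) 1 = deriv a x"
    by (simp add: has_field_derivative_def frechet_derivative_at[symmetric])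
qed

lemma smooth_onD: "smooth_on U f \<Longrightarrow> open U" "smooth_on U f \<Longrightarrow> ck_on k f U"
  by (auto simp: smooth_on_def)

lemma smooth_on_has_derivative:
  "smooth_on U f \<Longrightarrow> x \<in> U \<Longrightarrow> (f has_derivative frechet_derivative f (at x)) (at x)"
  by (metis ck_on_SucD(1) smooth_onD(2))

lemma smooth_on_cong:
  "smooth_on U f \<Longrightarrow> (\<And>x. x \<in> U \<Longrightarrow> f x = g x) \<Longrightarrow> smooth_on U g"
  unfolding smooth_on_def using ck_on_cong by blast

lemma smooth_on_frechet_derivative:
  "smooth_on U f \<Longrightarrow> smooth_on U (\<lambda>x. frechet_derivative f (at x) v)"
  unfolding smooth_on_def using ck_on_SucD(2) by blast

lemma has_derivative_compose_fst:
  "(g has_derivative g') (at x) \<Longrightarrow> ((\<lambda>y. g (fst y)) has_derivative (\<lambda>z. g' (fst z))) (at (x, t))"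
  by (rule has_derivative_compose[OF has_derivative_fst[OF has_derivative_ident]]) simp

lemma has_derivative_compose_snd:
  "(g has_derivative g') (at t) \<Longrightarrow> ((\<lambda>y. g (snd y)) has_derivative (\<lambda>z. g' (snd z))) (at (x, t))"
  by (rule has_derivative_compose[OF has_derivative_snd[OF has_derivative_ident]]) simp

lemma has_derivative_slice_left:
  assumes "(h has_derivative h') (at (x, s))"
  shows "((\<lambda>y. h (y, s)) has_derivative (\<lambda>u. h' (u, 0))) (at x)"
  using assms by (intro has_derivative_compose[of "\<lambda>y. (y, s)" "\<lambda>u. (u, 0)" x UNIV h h'])
    (auto intro!: derivative_eq_intros)

lemma has_derivative_slice_right:
  assumes "(h has_derivative h') (at (x, s))"
  shows "((\<lambda>t. h (x, t)) has_derivative (\<lambda>t. h' (0, t))) (at s)"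
  using assms by (intro has_derivative_compose[of "\<lambda>t. (x, t)" "\<lambda>t. (0, t)" s UNIV h h'])
    (auto intro!: derivative_eq_intros)

lemma smooth_on_compose:
  fixes f :: "'a::euclidean_space \<Rightarrow> 'b::euclidean_space" and g :: "'b \<Rightarrow> 'c::real_normed_vector"
  assumes "smooth_on U f" "smooth_on V g" "f ` U \<subseteq> V"
  shows "smooth_on U (\<lambda>x. g (f x))"
  using assms unfolding smooth_on_def by (auto intro: ck_on_compose)

lemma frechet_derivative_eqI:
  "(f has_derivative f') (at x) \<Longrightarrow> frechet_derivative f (at x) = f'"
  by (rule frechet_derivative_at[symmetric])

lemma smooth_on_deriv:
  fixes a :: "real \<Rightarrow> real"
  shows "smooth_on I a \<Longrightarrow> smooth_on I (deriv a)"
  unfolding smooth_on_def using ck_on_deriv by blast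

lemma smooth_on_scaleR:
  fixes f :: "'a::euclidean_space \<Rightarrow> real"
  shows "smooth_on U f \<Longrightarrow> smooth_on U g \<Longrightarrow> smooth_on U (\<lambda>x. f x *\<^sub>R g x)"
  unfolding smooth_on_def using ck_on_scaleR by blast

lemma smooth_on_Pair: "smooth_on U f \<Longrightarrow> smooth_on U g \<Longrightarrow> smooth_on U (\<lambda>x. (f x, g x))"
  unfolding smooth_on_def using ck_on_Pair by blast

lemma smooth_on_bounded_linear: "bounded_linear h \<Longrightarrow> smooth_on U f \<Longrightarrow> smooth_on U (\<lambda>x. h (f x))"
  unfolding smooth_on_def using ck_on_bounded_linear by blast

lemma smooth_on_ident: "open U \<Longrightarrow> smooth_on U (\<lambda>x. x)"
  unfolding smooth_on_def using ck_on_id by blast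

lemma smooth_on_const: "open U \<Longrightarrow> smooth_on U (\<lambda>x. c)"
  unfolding smooth_on_def using ck_on_const by blast

lemma smooth_on_has_real_derivative:
  fixes h :: "real \<Rightarrow> real"
  assumes "smooth_on I h" "s \<in> I"
  shows "(h has_real_derivative deriv h s) (at s)"
  using smooth_on_has_derivative[OF assms] DERIV_deriv_iff_real_differentiable differentiableI by blast

lemma smooth_on_imp_continuous_on: "smooth_on U f \<Longrightarrow> continuous_on U f"
  by (metis ck_on.simps(1) smooth_onD(2))

section \<open>Passing between a function and its integral representation\<close>

lemma deriv_eqI_interval_integral:
  fixes a h :: "real \<Rightarrow> real"
  assumes I: "open I" "is_interval I" and h: "continuous_on I h" and s: "s0 \<in> I" "s \<in> I"
    and a: "\<And>s. s \<in> I \<Longrightarrow> a s = (LBINT u=ereal s0..ereal s. h u)"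
  shows "deriv a s = h s"
proof -
  obtain e where e: "e > 0" "cball s e \<subseteq> I" using I(1) s(2) open_contains_cball by blast
  \<comment> \<open>A compact interval inside I that contains s0 and has s in its interior, on
    whichever side of s0 it lies, so that the derivative within the interval is a full one.\<close>
  define lo hi where "lo = min s0 (s - e)" and "hi = max s0 (s + e)"
  have "s - e \<in> cball s e" "s + e \<in> cball s e" using e(1) by (simp_all add: dist_real_def)
  then have "s - e \<in> I" "s + e \<in> I" using e(2) by blast+
  then have "lo \<in> I" "hi \<in> I" using s(1) by (simp_all add: lo_def hi_def min_def max_def)
  then have sub: "{lo..hi} \<subseteq> I" using mem_is_interval_1_I[OF I(2), of lo hi] by (intro subsetI) simp
  have bnd: "lo \<le> s0" "s0 \<le> hi" "lo < s" "s < hi"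
    using e(1) by (simp_all add: lo_def hi_def min_less_iff_disj less_max_iff_disj)
  have "((\<lambda>u. LBINT y=ereal s0..ereal u. h y) has_vector_derivative h s) (at s within {lo..hi})"
    using bnd by (intro interval_integral_FTC2 continuous_on_subset[OF h sub]) linarith+
  moreover have "at s within {lo..hi} = at s"
    by (rule at_within_interior) (simp add: bnd)
  ultimately have "((\<lambda>u. LBINT y=ereal s0..ereal u. h y) has_real_derivative h s) (at s)"
    by (simp only: has_real_derivative_iff_has_vector_derivative)
  then have "(a has_real_derivative h s) (at s)"
    by (rule has_field_derivative_transform_within_open[OF _ I(1) s(2)]) (simp add: a)
  then show ?thesis by (rule DERIV_imp_deriv)
qed

lemma interval_integral_deriv:
  fixes a :: "real \<Rightarrow> real"
  assumes a: "smooth_on I a" and I: "is_interval I" and s: "s0 \<in> I" "s \<in> I"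
  shows "(LBINT u=ereal s0..ereal s. deriv a u) = a s - a s0"
proof -
  have sub: "{min s0 s..max s0 s} \<subseteq> I"
  proof
    have "min s0 s \<in> I" "max s0 s \<in> I" using s by (simp_all add: min_def max_def)
    then show "x \<in> I" if "x \<in> {min s0 s..max s0 s}" for x
      using that by (meson I atLeastAtMost_iff mem_is_interval_1_I)
  qed
  show ?thesis
  proof (rule interval_integral_FTC_finite)
    show "continuous_on {min s0 s..max s0 s} (deriv a)"
      by (rule continuous_on_subset[OF smooth_on_imp_continuous_on[OF smooth_on_deriv[OF a]] sub])
    show "(a has_vector_derivative deriv a x) (at x within {min s0 s..max s0 s})"
      if "min s0 s \<le> x" "x \<le> max s0 s" for x
    proof -
      have "x \<in> I" using sub that by (meson atLeastAtMost_iff subsetD)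
      from smooth_on_has_real_derivative[OF a this] show ?thesis
        unfolding has_real_derivative_iff_has_vector_derivative by (rule has_vector_derivative_at_within)
    qed
  qed
qed

section \<open>Levi-Civita connection\<close>

text \<open>\<open>G x\<close> encodes the functional \<open>g x\<close> by its values on the basis.
  Definiteness makes G injective, since \<open>G x = 0\<close> gives \<open>g x x = 0\<close>; equal
  dimensions then make it onto.\<close>

lemma riesz_bilinear:
  fixes g :: "'e::euclidean_space \<Rightarrow> 'e \<Rightarrow> real"
  assumes g: "bilinear g" and pos: "\<And>u. u \<noteq> 0 \<Longrightarrow> g u u > 0" and h: "linear h"
  shows "\<exists>x. \<forall>v. g x v = h v"
proof -
  define G where "G x = (\<Sum>b\<in>Basis. g x b *\<^sub>R b)" for x
  have l: "linear (\<lambda>x. g x b)" and r: "linear (g x)" for b x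
    using g by (auto simp: bilinear_def)
  have rep: "k v = (\<Sum>b\<in>Basis. (v \<bullet> b) * k b)" if "linear k" for k :: "'e \<Rightarrow> real" and v
  proof -
    have "k v = k (\<Sum>b\<in>Basis. (v \<bullet> b) *\<^sub>R b)" by (simp add: euclidean_representation)
    also have "\<dots> = (\<Sum>b\<in>Basis. (v \<bullet> b) * k b)"
      using that by (simp only: linear_sum linear_cmul real_scaleR_def)
    finally show ?thesis .
  qed
  have Gb: "G x \<bullet> b = g x b" if "b \<in> Basis" for x b
    using that by (simp add: G_def inner_sum_left inner_Basis if_distrib sum.If_cases cong: if_cong)
  have G: "linear G"
    by (rule linearI) (simp_all add: G_def linear_add[OF l] linear_cmul[OF l] scaleR_add_left
        sum.distrib scaleR_sum_right)
  have "inj G"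
  proof (rule linear_injective_0[OF G, THEN iffD2], safe)
    fix x assume "G x = 0"
    then have "g x b = 0" if "b \<in> Basis" for b using Gb[OF that, of x] by simp
    then have "g x x = 0" using rep[OF r, of x x] by simp
    then show "x = 0" using pos[of x] by (cases "x = 0") auto
  qed
  then have "surj G" using G linear_injective_imp_surjective by blast
  then obtain x where x: "G x = (\<Sum>b\<in>Basis. h b *\<^sub>R b)" by (metis surjD)
  have "g x b = h b" if "b \<in> Basis" for b
    using Gb[OF that, of x] x that
    by (simp add: inner_sum_left inner_Basis if_distrib sum.If_cases cong: if_cong)
  then have "g x v = h v" for v by (simp add: rep[OF r, of x v] rep[OF h, of v])
  then show ?thesis by blast
qed

text \<open>The condition inside \<open>christoffel\<close> with the metric and its first
  derivatives at a point replaced by arbitrary g and D, so that existence and uniqueness become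
  linear algebra.\<close>

definition levi_civita_symbol :: "('e::euclidean_space \<Rightarrow> 'e \<Rightarrow> real) \<Rightarrow> ('e \<Rightarrow> 'e \<Rightarrow> 'e \<Rightarrow> real) \<Rightarrow>
    ('e \<Rightarrow> 'e \<Rightarrow> 'e) \<Rightarrow> bool" where
  "levi_civita_symbol g D \<Gamma> \<longleftrightarrow> bilinear \<Gamma> \<and> (\<forall>u v. \<Gamma> u v = \<Gamma> v u) \<and>
     (\<forall>w u v. D w u v = g (\<Gamma> w u) v + g u (\<Gamma> w v))"

lemma nondegenerate_eqI:
  assumes g: "bilinear g" and pos: "\<And>u. u \<noteq> 0 \<Longrightarrow> g u u > (0::real)"
    and eq: "\<And>v. g x v = g y v"
  shows "x = y"
proof -
  have "g (x - y) (x - y) = 0" by (simp add: bilinear_lsub[OF g] eq)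
  then show ?thesis using pos[of "x - y"] by (cases "x = y") auto
qed

text \<open>The Koszul formula for coordinate fields, whose brackets vanish. Expanding the
  right-hand side by compatibility, all terms cancel by symmetry except two copies of
  \<open>g (\<Gamma> w u) v\<close>.\<close>

lemma koszul:
  assumes "levi_civita_symbol g D \<Gamma>" and sym: "\<And>u v. g u v = g v u"
  shows "2 * g (\<Gamma> w u) v = D w u v + D u w v - D v w u"
proof -
  have D: "D w u v = g (\<Gamma> w u) v + g u (\<Gamma> w v)" and \<Gamma>: "\<Gamma> u v = \<Gamma> v u" for w u v
    using assms(1) unfolding levi_civita_symbol_def by blast+
  have "D u w v = g (\<Gamma> w u) v + g w (\<Gamma> u v)" by (simp only: D \<Gamma>[of u w])
  moreover have "D v w u = g (\<Gamma> w v) u + g w (\<Gamma> u v)" by (simp only: D \<Gamma>[of v w] \<Gamma>[of v u])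
  ultimately show ?thesis using D[of w u v] sym[of u "\<Gamma> w v"] by linarith
qed

lemma levi_civita_unique:
  assumes g: "bilinear g" and pos: "\<And>u. u \<noteq> 0 \<Longrightarrow> g u u > 0" and sym: "\<And>u v. g u v = g v u"
    and \<Gamma>: "levi_civita_symbol g D \<Gamma>" and \<Gamma>': "levi_civita_symbol g D \<Gamma>'"
  shows "\<Gamma> = \<Gamma>'"
proof (intro ext)
  fix w u
  show "\<Gamma> w u = \<Gamma>' w u"
  proof (rule nondegenerate_eqI[OF g pos])
    fix v
    have "2 * g (\<Gamma> w u) v = 2 * g (\<Gamma>' w u) v"
      by (simp only: koszul[OF \<Gamma> sym] koszul[OF \<Gamma>' sym])
    then show "g (\<Gamma> w u) v = g (\<Gamma>' w u) v" by simp
  qed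
qed

text \<open>The Koszul formula read backwards: its right-hand side is linear in v, hence represented
  by a vector, and that vector is taken as \<open>\<Gamma> w u\<close>. Symmetry and compatibility
  are then read off from the formula.\<close>

lemma levi_civita_exists:
  assumes g: "bilinear g" and pos: "\<And>u. u \<noteq> 0 \<Longrightarrow> g u u > 0" and sym: "\<And>u v. g u v = g v u"
    and D1: "\<And>u v. linear (\<lambda>w. D w u v)" and D2: "\<And>w v. linear (\<lambda>u. D w u v)"
    and Dsym: "\<And>w u v. D w u v = D w v u"
  shows "\<exists>\<Gamma>. levi_civita_symbol g D \<Gamma>"
proof -
  have D3: "linear (D w u)" for w u using D2[of w u] unfolding Dsym[of w _ u] .
  note lin = linear_add[OF D1] linear_add[OF D2] linear_add[OF D3]
    linear_cmul[OF D1] linear_cmul[OF D2] linear_cmul[OF D3]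
  define h where "h w u v = (D w u v + D u w v - D v w u) / 2" for w u v
  have "linear (h w u)" for w u
    by (rule linearI) (simp_all add: h_def lin field_simps)
  from riesz_bilinear[OF g pos this] have "\<exists>x. \<forall>v. g x v = h w u v" for w u by blast
  then obtain \<Gamma> where \<Gamma>: "g (\<Gamma> w u) v = h w u v" for w u v by metis
  note eqI = nondegenerate_eqI[OF g pos]
  have s: "\<Gamma> u v = \<Gamma> v u" for u v
    by (rule eqI) (auto simp: \<Gamma> h_def Dsym[of _ u v])
  have l: "linear (\<Gamma> u)" for u
    by (rule linearI; rule eqI)
       (auto simp: bilinear_ladd[OF g] bilinear_lmul[OF g] \<Gamma> h_def lin field_simps)
  then have "bilinear \<Gamma>" unfolding bilinear_def by (simp add: s[of _ ])
  moreover have "D w u v = g (\<Gamma> w u) v + g u (\<Gamma> w v)" for w u v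
    unfolding sym[of u "\<Gamma> w v"] \<Gamma> h_def using Dsym by (simp add: field_simps)
  ultimately show ?thesis using s unfolding levi_civita_symbol_def by blast
qed

lemma christoffel_eqI:
  assumes "bilinear (metric_at M i p)" "\<And>u. u \<noteq> 0 \<Longrightarrow> metric_at M i p u u > 0"
    "\<And>u v. metric_at M i p u v = metric_at M i p v u"
    and "levi_civita_symbol (metric_at M i p) (metric_derivative M i p) \<Gamma>"
  shows "christoffel M i p = \<Gamma>"
  unfolding christoffel_def
proof (rule the_equality)
  fix \<Gamma>' assume "bilinear \<Gamma>' \<and> (\<forall>u v. \<Gamma>' u v = \<Gamma>' v u) \<and>
        (\<forall>w u v. metric_derivative M i p w u v
           = metric_at M i p (\<Gamma>' w u) v + metric_at M i p u (\<Gamma>' w v))"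
  then show "\<Gamma>' = \<Gamma>"
    by (intro levi_civita_unique[OF assms(1,2,3) _ assms(4)]) (auto simp: levi_civita_symbol_def)
qed (use assms(4) in \<open>auto simp: levi_civita_symbol_def\<close>)

section \<open>Charts\<close>

lemma chart_facts:
  assumes "smooth_atlas M" "i \<in> charts M"
  shows open_chart_image: "open (chart_map M i ` chart_dom M i)"
    and chart_inv_chart_map: "p \<in> chart_dom M i \<Longrightarrow> chart_inv M i (chart_map M i p) = p"
    and inj_on_chart_map: "inj_on (chart_map M i) (chart_dom M i)"
proof -
  have h: "homeomorphism (chart_dom M i) (chart_map M i ` chart_dom M i)
          (chart_map M i) (chart_inv M i)"
    using assms unfolding smooth_atlas_def by blast
  show "open (chart_map M i ` chart_dom M i)"
    using assms unfolding smooth_atlas_def by blast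
  show "p \<in> chart_dom M i \<Longrightarrow> chart_inv M i (chart_map M i p) = p"
    using h by (simp add: homeomorphism_def)
  show "inj_on (chart_map M i) (chart_dom M i)"
    using h by (metis homeomorphism_def inj_on_inverseI)
qed

lemma real_line_simps [simp]:
  "charts real_line = {()}" "chart_dom real_line i = UNIV" "chart_map real_line i = (\<lambda>t. t)"
  "metric_at real_line i t u v = u * v" "chart_inv real_line i = (\<lambda>t. t)" "points real_line = UNIV"
  by (auto simp: real_line_def chart_inv_def points_def fun_eq_iff inv_into_def)

lemma riemannian_product_simps [simp]:
  "charts (riemannian_product M N) = charts M \<times> charts N"
  "chart_dom (riemannian_product M N) (i, j) = chart_dom M i \<times> chart_dom N j"
  "chart_map (riemannian_product M N) (i, j) = map_prod (chart_map M i) (chart_map N j)"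
  "metric_at (riemannian_product M N) (i, j) (p, q) (u, u') (v, v') =
     metric_at M i p u v + metric_at N j q u' v'"
  "points (riemannian_product M N) = points M \<times> points N"
  by (auto simp: riemannian_product_def points_def)

text \<open>\<open>chart_inv\<close> is an \<open>inv_into\<close> and so unspecified off the chart
  image. Hence the restriction on x, and the later transfer of derivatives along open subsets of
  that image.\<close>

lemma chart_inv_product_real_line:
  assumes "smooth_atlas M" "i \<in> charts M" "x \<in> chart_map M i ` chart_dom M i"
  shows "chart_inv (riemannian_product M real_line) (i, ()) (x, t) = (chart_inv M i x, t)"
proof -
  from assms(3) obtain p where p: "p \<in> chart_dom M i" "x = chart_map M i p" by blast
  have "inj_on (map_prod (chart_map M i) (\<lambda>t. t :: real)) (chart_dom M i \<times> UNIV)"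
    using inj_on_chart_map[OF assms(1,2)] by (auto simp: inj_on_def)
  then show ?thesis
    unfolding chart_inv_def[of "riemannian_product M real_line"]
    by (intro inv_into_f_eq) (auto simp: p chart_inv_chart_map[OF assms(1,2)])
qed

lemma riemannian_manifoldD:
  assumes "riemannian_manifold M"
  shows "smooth_atlas M"
    and "i \<in> charts M \<Longrightarrow> p \<in> chart_dom M i \<Longrightarrow> bilinear (metric_at M i p)"
    and "i \<in> charts M \<Longrightarrow> p \<in> chart_dom M i \<Longrightarrow> metric_at M i p u v = metric_at M i p v u"
    and "i \<in> charts M \<Longrightarrow> p \<in> chart_dom M i \<Longrightarrow> u \<noteq> 0 \<Longrightarrow> metric_at M i p u u > 0"
    and "i \<in> charts M \<Longrightarrow>
      smooth_on (chart_map M i ` chart_dom M i) (\<lambda>x. metric_at M i (chart_inv M i x) u v)"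
  using assms unfolding riemannian_manifold_def by blast+

context
  fixes M :: "('j, 'm::{t2_space, second_countable_topology}, 'e::euclidean_space) riemannian"
    and j :: 'j and q :: 'm
  assumes M: "riemannian_manifold M" and j: "j \<in> charts M" and q: "q \<in> chart_dom M j"
begin

lemma metric_has_derivative:
  "((\<lambda>x. metric_at M j (chart_inv M j x) u v) has_derivative
     (\<lambda>w. metric_derivative M j q w u v)) (at (chart_map M j q))"
  unfolding metric_derivative_def
  using smooth_on_has_derivative[OF riemannian_manifoldD(5)[OF M j], of "chart_map M j q" u v] q by auto

text \<open>Ensures that the description in \<open>christoffel\<close> denotes, so that its defining
  properties may be used.\<close>

lemma levi_civita_christoffel:
  "levi_civita_symbol (metric_at M j q) (metric_derivative M j q) (christoffel M j q)"
proof -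
  note g = riemannian_manifoldD(2-4)[OF M j q]
  let ?x = "chart_map M j q"
  have o: "open (chart_map M j ` chart_dom M j)" "?x \<in> chart_map M j ` chart_dom M j"
    using open_chart_image riemannian_manifoldD(1)[OF M] j q by auto
  have b: "bilinear (metric_at M j (chart_inv M j y))" "metric_at M j (chart_inv M j y) u v = metric_at M j (chart_inv M j y) v u"
    if "y \<in> chart_map M j ` chart_dom M j" for y u v
    using that riemannian_manifoldD(2,3)[OF M j] chart_inv_chart_map[OF riemannian_manifoldD(1)[OF M] j] by auto
  \<comment> \<open>Symmetry and bilinearity of the metric hold throughout the chart; by uniqueness
    of derivatives its derivative inherits them in the last two arguments.\<close>
  have eq: "D = metric_derivative M j q w u v"
    if "((\<lambda>x. metric_at M j (chart_inv M j x) u v) has_derivative D') (at ?x)" "D' w = D" for D D' w u v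
    using that has_derivative_unique[OF metric_has_derivative] by blast
  note tr = has_derivative_transform_within_open[OF _ o]
  have "\<exists>\<Gamma>. levi_civita_symbol (metric_at M j q) (metric_derivative M j q) \<Gamma>"
  proof (rule levi_civita_exists[OF g(1,3,2)])
    show "linear (\<lambda>w. metric_derivative M j q w u v)" for u v
      using metric_has_derivative has_derivative_linear by blast
    show "metric_derivative M j q w u v = metric_derivative M j q w v u" for w u v
      by (rule eq[OF tr[OF metric_has_derivative]]) (auto simp: b)
    show "linear (\<lambda>u. metric_derivative M j q w u v)" for w v
    proof (rule linearI)
      show "metric_derivative M j q w (x + y) v = metric_derivative M j q w x v + metric_derivative M j q w y v" for x y
        by (rule eq[OF tr[OF has_derivative_add[OF metric_has_derivative metric_has_derivative]], symmetric])
           (auto simp: bilinear_ladd[OF b(1)])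
      show "metric_derivative M j q w (c *\<^sub>R x) v = c *\<^sub>R metric_derivative M j q w x v" for c x
        by (rule eq[OF tr[OF has_derivative_scaleR_right[OF metric_has_derivative]], symmetric])
           (auto simp: bilinear_lmul[OF b(1)])
    qed
  qed auto
  then show ?thesis using christoffel_eqI[OF g(1,3,2)] by metis
qed

text \<open>The product metric does not depend on t and its vertical part is constant, so no
  derivative of it has a vertical contribution. The stated symbol then satisfies the Levi-Civita
  conditions, and uniqueness identifies it.\<close>

lemma christoffel_product_real_line:
  "christoffel (riemannian_product M real_line) (j, ()) (q, t) (u, \<sigma>) (v, \<tau>)
     = (christoffel M j q u v, 0)"
proof -
  let ?R = "riemannian_product M real_line"
  note g = riemannian_manifoldD(2-4)[OF M j q]
  note lc = levi_civita_christoffel[unfolded levi_civita_symbol_def]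
  have o: "open (chart_map M j ` chart_dom M j \<times> (UNIV::real set))"
    "(chart_map M j q, t) \<in> chart_map M j ` chart_dom M j \<times> UNIV"
    using open_Times[OF open_chart_image[OF riemannian_manifoldD(1)[OF M] j] open_UNIV] q by auto
  have d: "metric_derivative ?R (j, ()) (q, t) (w, r) (u, \<sigma>) (v, \<tau>) = metric_derivative M j q w u v"
    for w r u \<sigma> v \<tau>
  proof -
    have "((\<lambda>y. metric_at M j (chart_inv M j (fst y)) u v) has_derivative
       (\<lambda>z. metric_derivative M j q (fst z) u v)) (at (chart_map M j q, t))"
      by (rule has_derivative_compose_fst[OF metric_has_derivative])
    from has_derivative_add[OF this has_derivative_const[of "\<sigma> * \<tau>"]]
    have "((\<lambda>y. metric_at ?R (j, ()) (chart_inv ?R (j, ()) y) (u, \<sigma>) (v, \<tau>)) has_derivative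
       (\<lambda>z. metric_derivative M j q (fst z) u v + 0)) (at (chart_map M j q, t))"
      by (rule has_derivative_transform_within_open[OF _ o])
         (auto simp: chart_inv_product_real_line[OF riemannian_manifoldD(1)[OF M] j])
    then show ?thesis by (simp add: metric_derivative_def frechet_derivative_eqI)
  qed
  have "christoffel ?R (j, ()) (q, t) = (\<lambda>(u, _) (v, _). (christoffel M j q u v, 0))"
  proof (rule christoffel_eqI)
    show "bilinear (metric_at ?R (j, ()) (q, t))"
      unfolding bilinear_def
      by (auto intro!: linearI simp: bilinear_ladd[OF g(1)] bilinear_radd[OF g(1)]
          bilinear_lmul[OF g(1)] bilinear_rmul[OF g(1)] algebra_simps)
    show "metric_at ?R (j, ()) (q, t) u u > 0" if "u \<noteq> 0" for u
    proof (cases u)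
      case (Pair a b)
      have "metric_at M j q a a \<ge> 0"
        using g(3)[of a] bilinear_lzero[OF g(1), of 0] by (cases "a = 0") auto
      moreover have "b \<noteq> 0 \<Longrightarrow> b * b > 0" by (metis not_real_square_gt_zero)
      ultimately show ?thesis using g(3)[of a] that Pair
        by (cases "a = 0"; cases "b = 0") (auto simp: zero_prod_def intro: add_pos_nonneg add_nonneg_pos)
    qed
    show "metric_at ?R (j, ()) (q, t) u v = metric_at ?R (j, ()) (q, t) v u" for u v
      by (cases u; cases v) (simp add: mult.commute, rule g(2))
    show "levi_civita_symbol (metric_at ?R (j, ()) (q, t)) (metric_derivative ?R (j, ()) (q, t))
      (\<lambda>(u, _) (v, _). (christoffel M j q u v, 0))"
      unfolding levi_civita_symbol_def
    proof safe
      have b: "bilinear (christoffel M j q)" using lc by blast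
      show "bilinear (\<lambda>(u, _) (v, _). (christoffel M j q u v, 0::real))"
        unfolding bilinear_def
        by (auto intro!: linearI simp: bilinear_ladd[OF b] bilinear_radd[OF b]
          bilinear_lmul[OF b] bilinear_rmul[OF b])
    qed (use lc in \<open>simp_all add: d\<close>)
  qed
  then show ?thesis by simp
qed

end

section \<open>The shape operator\<close>

lemma bilinear_expansion:
  fixes h :: "'e::euclidean_space \<Rightarrow> 'e \<Rightarrow> real"
  assumes "bilinear h"
  shows "h x y = (\<Sum>a\<in>Basis. \<Sum>b\<in>Basis. (x \<bullet> a) * (y \<bullet> b) * h a b)"
proof -
  have "h x y = h (\<Sum>a\<in>Basis. (x \<bullet> a) *\<^sub>R a) (\<Sum>b\<in>Basis. (y \<bullet> b) *\<^sub>R b)"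
    by (simp add: euclidean_representation)
  also have "\<dots> = (\<Sum>(a, b)\<in>Basis \<times> Basis. h ((x \<bullet> a) *\<^sub>R a) ((y \<bullet> b) *\<^sub>R b))"
    by (rule bilinear_sum[OF assms])
  also have "\<dots> = (\<Sum>a\<in>Basis. \<Sum>b\<in>Basis. (x \<bullet> a) * (y \<bullet> b) * h a b)"
    by (simp add: sum.cartesian_product bilinear_lmul[OF assms] bilinear_rmul[OF assms] mult_ac)
  finally show ?thesis .
qed

text \<open>Derivatives of m are given for fixed arguments only. Expanding both fields in the basis
  reduces the claim to the product rule for finitely many real functions.\<close>

lemma has_derivative_bilinear_field:
  fixes m :: "'a::real_normed_vector \<Rightarrow> 'e::euclidean_space \<Rightarrow> 'e \<Rightarrow> real"
  assumes m: "\<And>u v. ((\<lambda>x. m x u v) has_derivative (\<lambda>h. m' h u v)) (at x0)"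
    and b: "\<And>x. x \<in> U \<Longrightarrow> bilinear (m x)" and b': "\<And>h. bilinear (m' h)"
    and U: "open U" "x0 \<in> U"
    and V: "(V has_derivative V') (at x0)" and W: "(W has_derivative W') (at x0)"
  shows "((\<lambda>x. m x (V x) (W x)) has_derivative
    (\<lambda>h. m' h (V x0) (W x0) + m x0 (V' h) (W x0) + m x0 (V x0) (W' h))) (at x0)"
proof -
  have "((\<lambda>x. \<Sum>a\<in>Basis. \<Sum>b\<in>Basis. (V x \<bullet> a) * (W x \<bullet> b) * m x a b) has_derivative
    (\<lambda>h. \<Sum>a\<in>Basis. \<Sum>b\<in>Basis. (V x0 \<bullet> a) * (W x0 \<bullet> b) * m' h a b
       + ((V x0 \<bullet> a) * (W' h \<bullet> b) + (V' h \<bullet> a) * (W x0 \<bullet> b)) * m x0 a b)) (at x0)"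
    by (intro has_derivative_sum has_derivative_mult has_derivative_inner_left V W m)
  then have "((\<lambda>x. \<Sum>a\<in>Basis. \<Sum>b\<in>Basis. (V x \<bullet> a) * (W x \<bullet> b) * m x a b) has_derivative
    (\<lambda>h. m' h (V x0) (W x0) + m x0 (V' h) (W x0) + m x0 (V x0) (W' h))) (at x0)"
    by (rule has_derivative_eq_rhs)
       (simp add: fun_eq_iff bilinear_expansion[OF b', where x = "V x0" and y = "W x0"]
         bilinear_expansion[OF b[OF U(2)], where x = "V' _" and y = "W x0"]
         bilinear_expansion[OF b[OF U(2)], where x = "V x0" and y = "W' _"] sum.distrib algebra_simps)
  then show ?thesis
    by (rule has_derivative_transform_within_open[OF _ U])
      (simp add: bilinear_expansion[OF b, where x = "V _" and y = "W _"])
qed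

text \<open>Adjoining n to the range of L gives the injective map K between spaces of equal
  dimension, hence a surjection. Pairing with n reads off the coefficient c, which vanishes for v
  orthogonal to n.\<close>

lemma hyperplane_eq_range:
  fixes L :: "'d::euclidean_space \<Rightarrow> 'e::euclidean_space" and g :: "'e \<Rightarrow> 'e \<Rightarrow> real"
  assumes dim: "DIM('d) + 1 = DIM('e)" and L: "linear L" "inj L" and g: "bilinear g"
    and orth: "\<And>u. g (L u) n = 0" and n: "g n n = 1" and v: "g v n = 0"
  shows "\<exists>w. L w = v"
proof -
  define K where "K = (\<lambda>(w, c::real). L w + c *\<^sub>R n)"
  have K: "linear K"
    by (rule linearI) (auto simp: K_def linear_add[OF L(1)] linear_cmul[OF L(1)] algebra_simps)
  have gK: "g (K (w, c)) n = c" for w c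
    by (simp add: K_def bilinear_ladd[OF g] bilinear_lmul[OF g] orth n)
  have "inj K"
  proof (rule linear_injective_0[OF K, THEN iffD2], safe)
    fix w c assume K0: "K (w, c) = 0"
    then have c: "c = 0" using gK[of w c] bilinear_lzero[OF g] by simp
    with K0 have "L w = 0" by (simp add: K_def)
    then show "(w, c) = 0" using L c linear_injective_0 by (auto simp: zero_prod_def)
  qed
  then have "dim (range K) = DIM('d \<times> real)" using K by (simp add: dim_image_eq)
  then have "span (range K) = UNIV" using dim by (simp add: dim_eq_full[symmetric])
  then have "range K = UNIV"
    using linear_subspace_image[OF K subspace_UNIV] by (simp add: span_eq_iff[THEN iffD2])
  then obtain w c where wc: "v = K (w, c)" by (metis surj_pair rangeE UNIV_I)
  with gK v have "c = 0" by simp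
  with wc show ?thesis by (auto simp: K_def)
qed

lemma smooth_map_localD:
  assumes "smooth_map S M W F" "i \<in> charts S" "j \<in> charts M" "p \<in> W" "p \<in> chart_dom S i"
    "F p \<in> chart_dom M j"
  shows "((chart_map M j \<circ> F \<circ> chart_inv S i) has_derivative differential S M F i j p)
    (at (chart_map S i p))"
  unfolding differential_def
  by (rule smooth_on_has_derivative) (use assms in \<open>auto simp: smooth_map_def\<close>)

lemma differential_eqI:
  "((chart_map M j \<circ> F \<circ> chart_inv S i) has_derivative D) (at (chart_map S i p)) \<Longrightarrow>
     differential S M F i j p = D"
  unfolding differential_def by (rule frechet_derivative_eqI)

text \<open>Differentiating \<open>\<langle>N, N\<rangle> = 1\<close> shows that \<open>\<nabla>\<^sub>u N\<close> is tangential; without this the definite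
  description in \<open>shape_operator\<close> would be unspecified.\<close>

lemma shape_operator_exists:
  fixes S :: "('i, 's::{t2_space, second_countable_topology}, 'd::euclidean_space) riemannian"
    and M :: "('j, 'm::{t2_space, second_countable_topology}, 'e::euclidean_space) riemannian"
  assumes S: "smooth_atlas S" and M: "riemannian_manifold M" and hyp: "oriented_hypersurface S M W F N"
    and ij: "i \<in> charts S" "j \<in> charts M" and p: "p \<in> W" "p \<in> chart_dom S i" "F p \<in> chart_dom M j"
  shows "\<exists>w. differential S M F i j p w = - covariant_derivative S M F N i j p u"
proof -
  let ?x = "chart_map S i p" and ?L = "differential S M F i j p" and ?g = "metric_at M j (F p)"
  let ?V = "\<lambda>x. N (chart_inv S i x) j" and ?F = "chart_map M j \<circ> F \<circ> chart_inv S i"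
  let ?U = "chart_map S i ` (W \<inter> chart_dom S i \<inter> F -` chart_dom M j)"
  note Mat = riemannian_manifoldD(1)[OF M]
  note inv = chart_inv_chart_map[OF S ij(1)] chart_inv_chart_map[OF Mat ij(2)]
  have sm: "smooth_map S M W F" and V: "smooth_on ?U ?V" and "inj ?L"
    and dim: "DIM('d) + 1 = DIM('e)"
    using hyp ij p unfolding oriented_hypersurface_def immersion_def vector_field_along_def by blast+
  have unit: "metric_at M j (F q) (N q j) (N q j) = 1"
    and orth: "metric_at M j (F q) (differential S M F i j q u) (N q j) = 0"
    if "q \<in> W" "q \<in> chart_dom S i" "F q \<in> chart_dom M j" for q u
    using hyp ij that unfolding oriented_hypersurface_def by blast+
  have U: "open ?U" "?x \<in> ?U" using smooth_onD(1)[OF V] p by auto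
  have L: "(?F has_derivative ?L) (at ?x)" by (rule smooth_map_localD[OF sm ij p])
  have V': "(?V has_derivative frechet_derivative ?V (at ?x)) (at ?x)"
    by (rule smooth_on_has_derivative[OF V U(2)])
  let ?V' = "frechet_derivative ?V (at ?x)"
  note g = riemannian_manifoldD(2-4)[OF M ij(2)]
  note lc = levi_civita_christoffel[OF M ij(2) p(3), unfolded levi_civita_symbol_def]
  have D: "metric_derivative M j (F p) w u v = ?g (christoffel M j (F p) w u) v + ?g u (christoffel M j (F p) w v)"
    and \<Gamma>: "bilinear (christoffel M j (F p))" for w u v
    using lc by blast+
  have "((\<lambda>x. metric_at M j (chart_inv M j (?F x)) (?V x) (?V x)) has_derivative
     (\<lambda>h. metric_derivative M j (F p) (?L h) (?V ?x) (?V ?x)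
        + metric_at M j (chart_inv M j (?F ?x)) (?V' h) (?V ?x)
        + metric_at M j (chart_inv M j (?F ?x)) (?V ?x) (?V' h))) (at ?x)"
  proof (rule has_derivative_bilinear_field[where m = "\<lambda>x. metric_at M j (chart_inv M j (?F x))"
        and m' = "\<lambda>h. metric_derivative M j (F p) (?L h)", OF _ _ _ U V' V'])
    show "((\<lambda>x. metric_at M j (chart_inv M j (?F x)) u v) has_derivative
        (\<lambda>h. metric_derivative M j (F p) (?L h) u v)) (at ?x)" for u v
      using has_derivative_compose[OF L, of "\<lambda>y. metric_at M j (chart_inv M j y) u v"]
        metric_has_derivative[OF M ij(2) p(3), of u v] p inv by simp
    show "bilinear (metric_at M j (chart_inv M j (?F x)))" if "x \<in> ?U" for x
      using that g(1) inv by auto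
    show "bilinear (metric_derivative M j (F p) (?L h))" for h
      unfolding bilinear_def D
      by (auto intro!: linearI simp: bilinear_ladd[OF \<Gamma>] bilinear_radd[OF \<Gamma>] bilinear_lmul[OF \<Gamma>]
          bilinear_rmul[OF \<Gamma>] bilinear_ladd[OF g(1)[OF p(3)]] bilinear_radd[OF g(1)[OF p(3)]]
          bilinear_lmul[OF g(1)[OF p(3)]] bilinear_rmul[OF g(1)[OF p(3)]] algebra_simps)
  qed
  moreover have "((\<lambda>x. metric_at M j (chart_inv M j (?F x)) (?V x) (?V x)) has_derivative (\<lambda>h. 0)) (at ?x)"
    by (rule has_derivative_transform_within_open[OF has_derivative_const[of 1] U]) (auto simp: inv unit)
  ultimately have "(\<lambda>h. metric_derivative M j (F p) (?L h) (?V ?x) (?V ?x)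
        + metric_at M j (chart_inv M j (?F ?x)) (?V' h) (?V ?x)
        + metric_at M j (chart_inv M j (?F ?x)) (?V ?x) (?V' h)) = (\<lambda>h. 0)"
    by (rule has_derivative_unique)
  then have "metric_derivative M j (F p) (?L u) (?V ?x) (?V ?x)
        + metric_at M j (chart_inv M j (?F ?x)) (?V' u) (?V ?x)
        + metric_at M j (chart_inv M j (?F ?x)) (?V ?x) (?V' u) = 0"
    by (rule fun_cong)
  \<comment> \<open>By metric compatibility and symmetry these three terms add up to twice the
    product of the covariant derivative of N with N.\<close>
  then have "metric_derivative M j (F p) (?L u) (N p j) (N p j) + ?g (?V' u) (N p j) + ?g (N p j) (?V' u) = 0"
    using p inv by simp
  then have "?g (covariant_derivative S M F N i j p u) (N p j) = 0"
    using g(2)[OF p(3), of "N p j" "?V' u"] g(2)[OF p(3), of "N p j" "christoffel M j (F p) (?L u) (N p j)"]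
    unfolding covariant_derivative_def D bilinear_ladd[OF g(1)[OF p(3)]] by linarith
  then have "?g (- covariant_derivative S M F N i j p u) (N p j) = 0"
    by (simp add: bilinear_lneg[OF g(1)[OF p(3)]])
  then show ?thesis
    by (intro hyperplane_eq_range[OF dim has_derivative_linear[OF L] \<open>inj ?L\<close> g(1)[OF p(3)]])
       (auto simp: orth unit p)
qed

lemma shape_operator_eqI:
  assumes "inj (differential S M F i j p)"
    and "differential S M F i j p w = - covariant_derivative S M F N i j p u"
  shows "shape_operator S M F N i j p u = w"
  unfolding shape_operator_def
  by (rule the_equality) (use assms in \<open>auto simp: inj_def\<close>)

lemma differential_identity_product_real_line:
  assumes M: "smooth_atlas M" and jk: "j \<in> charts M" "k \<in> charts M"
    and q: "q \<in> chart_dom M j \<inter> chart_dom M k"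
  defines "R \<equiv> riemannian_product M real_line"
  shows "differential R R (\<lambda>x. x) (j, ()) (k, ()) (q, t) (u, \<tau>) = (differential M M (\<lambda>x. x) j k q u, \<tau>)"
    and "linear (differential M M (\<lambda>x. x) j k q)"
proof -
  have sm: "smooth_on (chart_map M j ` (chart_dom M j \<inter> chart_dom M k)) (chart_map M k \<circ> chart_inv M j)"
    using M jk unfolding smooth_atlas_def by blast
  have d: "((chart_map M k \<circ> chart_inv M j) has_derivative differential M M (\<lambda>x. x) j k q) (at (chart_map M j q))"
    using smooth_on_has_derivative[OF sm, of "chart_map M j q"] q by (simp add: differential_def comp_def)
  then show "linear (differential M M (\<lambda>x. x) j k q)" by (rule has_derivative_linear)
  have "((\<lambda>y. ((chart_map M k \<circ> chart_inv M j) (fst y), snd y)) has_derivative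
       (\<lambda>z. (differential M M (\<lambda>x. x) j k q (fst z), snd z))) (at (chart_map M j q, t))"
    by (intro has_derivative_Pair has_derivative_snd has_derivative_ident has_derivative_compose_fst d)
  then have "((chart_map R (k, ()) \<circ> (\<lambda>x. x) \<circ> chart_inv R (j, ())) has_derivative
       (\<lambda>z. (differential M M (\<lambda>x. x) j k q (fst z), snd z))) (at (chart_map M j q, t))"
    by (rule has_derivative_transform_within_open[where s = "chart_map M j ` chart_dom M j \<times> UNIV"])
       (use open_Times[OF open_chart_image[OF M jk(1)] open_UNIV] q in
         \<open>auto simp: R_def chart_inv_product_real_line[OF M jk(1)]\<close>)
  then have "differential R R (\<lambda>x. x) (j, ()) (k, ()) (q, t)
      = (\<lambda>z. (differential M M (\<lambda>x. x) j k q (fst z), snd z))"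
    by (intro differential_eqI) (simp add: R_def)
  then show "differential R R (\<lambda>x. x) (j, ()) (k, ()) (q, t) (u, \<tau>) = (differential M M (\<lambda>x. x) j k q u, \<tau>)"
    by simp
qed

text \<open>A change of charts leaves the vertical component c alone and is linear horizontally, so
  the factors c and b cancel. They are nonzero, which gives an equivalence: orientations are later
  transferred both from the slices to the graph and back.\<close>

lemma tangent_vector_product_real_line:
  assumes M: "smooth_atlas M" and c: "c \<noteq> 0" "b \<noteq> 0"
    and N: "\<And>j. N (j, ()) = c *\<^sub>R (b *\<^sub>R V j, 1)"
  shows "tangent_vector (riemannian_product M real_line) (q, t) N \<longleftrightarrow> tangent_vector M q V"
proof -
  have "N (k, ()) = differential (riemannian_product M real_line) (riemannian_product M real_line)
      (\<lambda>x. x) (j, ()) (k, ()) (q, t) (N (j, ())) \<longleftrightarrow> V k = differential M M (\<lambda>x. x) j k q (V j)"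
    if "j \<in> charts M" "k \<in> charts M" "q \<in> chart_dom M j \<inter> chart_dom M k" for j k
    using differential_identity_product_real_line(1)[OF M that, of t "c *\<^sub>R b *\<^sub>R V j" c] c
      linear_cmul[OF differential_identity_product_real_line(2)[OF M that]]
    by (simp add: N)
  then show ?thesis unfolding tangent_vector_def by (auto simp: N)
qed

lemma endo_trace_prod:
  fixes A :: "'d::euclidean_space \<times> real \<Rightarrow> 'd \<times> real"
  assumes "\<And>u t. A (u, t) = (B u, c * t)"
  shows "endo_trace A = endo_trace B + c"
proof -
  have "endo_trace A = (\<Sum>b\<in>Basis. A (b, 0) \<bullet> (b, 0)) + (\<Sum>b\<in>Basis. A (0, b) \<bullet> (0, b))"
    unfolding endo_trace_def Basis_prod_def
    by (subst sum.union_disjoint) (auto simp: sum.reindex inj_on_def)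
  then show ?thesis by (simp add: assms endo_trace_def)
qed

lemma endo_trace_scaleR: "endo_trace (\<lambda>u. c *\<^sub>R A u) = c * endo_trace A"
  by (simp add: endo_trace_def sum_distrib_left)

section \<open>The profile function\<close>

text \<open>This is \<rho>, the coefficient of -\<eta>_s in the graph normal; \<Theta> and \<rho>
  are the cosine and sine of the angle between N and the vertical field.\<close>

definition profile :: "(real \<Rightarrow> real) \<Rightarrow> real \<Rightarrow> real" where
  "profile a s = deriv a s * graph_angle a s"

lemma graph_angle_pos: "graph_angle a s > 0"
  by (simp add: graph_angle_def add_pos_nonneg)

lemma graph_angle_profile_squares: "(graph_angle a s)\<^sup>2 + (profile a s)\<^sup>2 = 1"
proof -
  have "1 + (deriv a s)\<^sup>2 > 0" by (simp add: add_pos_nonneg)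
  then show ?thesis
    by (simp add: profile_def graph_angle_def power_divide power_mult_distrib field_simps)
qed

lemma profile_bounds: "deriv a s > 0 \<Longrightarrow> 0 < profile a s \<and> profile a s < 1"
proof -
  assume "deriv a s > 0"
  moreover have "(profile a s)\<^sup>2 < 1"
    using graph_angle_profile_squares[of a s] zero_less_power[OF graph_angle_pos[of a s], of 2] by linarith
  ultimately show ?thesis
    by (auto simp: profile_def graph_angle_pos abs_square_less_1)
qed

text \<open>The square root is \<Theta>, so the quotient is \<rho>/\<Theta>. This turns the
  integrand of the profile formula into the derivative of a.\<close>

lemma profile_divide_sqrt: "profile a s / sqrt (1 - (profile a s)\<^sup>2) = deriv a s"
proof -
  have "1 - (profile a s)\<^sup>2 = (graph_angle a s)\<^sup>2" using graph_angle_profile_squares[of a s] by linarith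
  then show ?thesis using graph_angle_pos[of a s] by (simp add: profile_def)
qed

text \<open>The inverse passage from a' to \<rho>: it identifies a prescribed solution of the
  differential equation with the profile of the graph that it defines.\<close>

lemma profile_eqI:
  assumes "0 < r" "r < 1" "deriv a s = r / sqrt (1 - r\<^sup>2)"
  shows "profile a s = r"
proof -
  have r: "1 - r\<^sup>2 > 0" using assms by (simp add: power_less_one_iff)
  then have "1 + (deriv a s)\<^sup>2 = 1 / (1 - r\<^sup>2)"
    by (simp add: assms(3) power_divide field_simps)
  then have "graph_angle a s = sqrt (1 - r\<^sup>2)" by (simp add: graph_angle_def real_sqrt_divide)
  then show ?thesis using r by (simp add: profile_def assms(3))
qed

lemma smooth_on_graph_angle:
  assumes "smooth_on I a"
  shows "smooth_on I (graph_angle a)"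
proof -
  have I: "open I" and d: "ck_on k (deriv a) I" for k
    using smooth_on_deriv[OF assms] by (auto simp: smooth_on_def)
  have "ck_on k (\<lambda>s. (1 + deriv a s *\<^sub>R deriv a s) powr (- 1 / 2)) I" for k
  proof (rule ck_on_compose[OF I _ ck_on_powr])
    show "ck_on k (\<lambda>s. 1 + deriv a s *\<^sub>R deriv a s) I"
      by (intro ck_on_add[OF I] ck_on_const ck_on_scaleR[OF I] d)
  qed (auto intro: add_pos_nonneg)
  moreover have "(1 + deriv a s *\<^sub>R deriv a s) powr (- 1 / 2) = graph_angle a s" for s
    by (simp add: graph_angle_def power2_eq_square powr_minus_divide powr_half_sqrt)
  ultimately show ?thesis using I by (simp add: smooth_on_def)
qed

lemma smooth_on_profile: "smooth_on I a \<Longrightarrow> smooth_on I (profile a)"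
  using smooth_on_scaleR[OF smooth_on_deriv smooth_on_graph_angle, of I a]
  by (simp add: profile_def[abs_def])

text \<open>Differentiating \<open>\<Theta>\<^sup>2 + \<rho>\<^sup>2 = 1\<close> with \<open>\<rho> = a' \<Theta>\<close> and cancelling \<open>\<Theta>\<close>.\<close>

lemma deriv_graph_angle:
  assumes a: "smooth_on I a" and s: "s \<in> I"
  shows "deriv (graph_angle a) s = - (deriv a s * deriv (profile a) s)"
proof -
  have "((\<lambda>x. (graph_angle a x)\<^sup>2 + (profile a x)\<^sup>2) has_real_derivative
     (2 * graph_angle a s * deriv (graph_angle a) s + 2 * profile a s * deriv (profile a) s)) (at s)"
    using smooth_on_has_real_derivative[OF smooth_on_graph_angle[OF a] s]
      smooth_on_has_real_derivative[OF smooth_on_profile[OF a] s]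
    by (auto intro!: derivative_eq_intros)
  then have "2 * graph_angle a s * deriv (graph_angle a) s + 2 * profile a s * deriv (profile a) s = 0"
    unfolding graph_angle_profile_squares by (rule DERIV_unique[OF _ DERIV_const])
  then have "2 * graph_angle a s * (deriv (graph_angle a) s + deriv a s * deriv (profile a) s) = 0"
    by (simp add: profile_def algebra_simps)
  then show ?thesis using graph_angle_pos[of a s] by auto
qed

section \<open>The graph in charts\<close>

locale parallel_graph =
  fixes M :: "('j, 'm::{t2_space, second_countable_topology}, 'e::euclidean_space) riemannian"
    and S :: "('i, 's::{t2_space, second_countable_topology}, 'd::euclidean_space) riemannian"
    and f :: "'s \<Rightarrow> 'm" and \<eta> :: "'s \<Rightarrow> 'j \<Rightarrow> 'e" and I :: "real set" and a :: "real \<Rightarrow> real"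
  assumes graph: "fs_a_graph S M f \<eta> I a"
begin

abbreviation P where "P \<equiv> parallel_map M f \<eta>"
abbreviation V where "V \<equiv> parallel_normal M f \<eta>"
abbreviation SR where "SR \<equiv> riemannian_product S real_line"
abbreviation MR where "MR \<equiv> riemannian_product M real_line"
abbreviation F where "F \<equiv> graph_map M f \<eta> a"
abbreviation N where "N \<equiv> graph_normal M f \<eta> a"

text \<open>The coordinate domain on which smoothness of (p, s) |-> f_s(p) is tested. The graph has
  the same one, because the vertical chart is global.\<close>

definition flow_dom where
  "flow_dom i j = {(x, s). x \<in> chart_map S i ` chart_dom S i \<and> s \<in> I \<and> P s (chart_inv S i x) \<in> chart_dom M j}"

text \<open>The whole parallel family as one map of (x, s), so that differentials of the slices,
  velocities of the geodesics and the differential of the graph are all restrictions of a single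
  derivative.\<close>

definition flow where
  "flow i j = (\<lambda>(x, s). chart_map M j (P s (chart_inv S i x)))"

abbreviation flow_deriv where "flow_deriv i j z \<equiv> frechet_derivative (flow i j) (at z)"

text \<open>The coordinate expression of \<eta>_s. As a partial derivative of a smooth map it is
  smooth in (x, s) jointly.\<close>

definition flow_normal where "flow_normal i j z = flow_deriv i j z (0, 1)"

lemma S: "riemannian_manifold S" and M: "riemannian_manifold M" and I: "open I"
  and geodesic: "p \<in> points S \<Longrightarrow> geodesic M I (\<lambda>s. P s p)"
  and smooth_P: "smooth_map SR M (points S \<times> I) (\<lambda>(p, s). P s p)"
  and immersion_P: "s \<in> I \<Longrightarrow> immersion S M (points S) (P s)"
  and a: "smooth_on I a" and a_pos: "s \<in> I \<Longrightarrow> deriv a s > 0"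
  and dim: "DIM('d) + 1 = DIM('e)" and interval: "is_interval I"
  using graph unfolding fs_a_graph_def parallel_family_def geodesic_from_def oriented_hypersurface_def
  by blast+

lemmas atlas = riemannian_manifoldD(1)[OF S] riemannian_manifoldD(1)[OF M]

lemma chart_dom_points: "i \<in> charts S \<Longrightarrow> chart_dom S i \<subseteq> points S"
  by (auto simp: points_def)

lemma flow_dom_eq:
  assumes "i \<in> charts S"
  shows "chart_map SR (i, ()) ` ((points S \<times> I) \<inter> chart_dom SR (i, ()) \<inter> (\<lambda>(p, s). P s p) -` chart_dom M j)
    = flow_dom i j"
    (is "?A = _")
proof (intro equalityI subsetI)
  show "z \<in> flow_dom i j" if "z \<in> ?A" for z
    using that by (auto simp: flow_dom_def chart_inv_chart_map[OF atlas(1) assms])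
  fix z assume "z \<in> flow_dom i j"
  then obtain p s where "z = (chart_map S i p, s)" "p \<in> chart_dom S i" "s \<in> I" "P s p \<in> chart_dom M j"
    by (auto simp: flow_dom_def chart_inv_chart_map[OF atlas(1) assms])
  then show "z \<in> ?A"
    using chart_dom_points[OF assms] by (intro image_eqI[of _ _ "(p, s)"]) auto
qed

lemma smooth_flow:
  assumes "i \<in> charts S" "j \<in> charts M"
  shows "smooth_on (flow_dom i j) (flow i j)"
proof -
  have "smooth_on (flow_dom i j) (chart_map M j \<circ> (\<lambda>(p, s). P s p) \<circ> chart_inv SR (i, ()))"
    using smooth_P assms flow_dom_eq[OF assms(1), symmetric] unfolding smooth_map_def by simp
  then show ?thesis
    by (rule smooth_on_cong)
       (auto simp: flow_dom_def flow_def chart_inv_product_real_line[OF atlas(1) assms(1)])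
qed

lemma smooth_flow_normal:
  assumes "i \<in> charts S" "j \<in> charts M"
  shows "smooth_on (flow_dom i j) (flow_normal i j)"
  using smooth_on_frechet_derivative[OF smooth_flow[OF assms], of "(0, 1)"]
  by (simp add: flow_normal_def[abs_def])

lemma slice_dom:
  assumes "i \<in> charts S" "s \<in> I"
  shows "chart_map S i ` (points S \<inter> chart_dom S i \<inter> P s -` chart_dom M j) = (\<lambda>x. (x, s)) -` flow_dom i j"
  using chart_dom_points[OF assms(1)] assms(2)
  by (auto simp: flow_dom_def chart_inv_chart_map[OF atlas(1) assms(1)])

lemma velocity_flow:
  assumes ij: "i \<in> charts S" "j \<in> charts M" and z: "(x, s) \<in> flow_dom i j"
  shows "differential real_line M (\<lambda>t. P t (chart_inv S i x)) () j s t = t *\<^sub>R flow_normal i j (x, s)"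
    and "V s (chart_inv S i x) j = flow_normal i j (x, s)"
proof -
  have D: "(flow i j has_derivative flow_deriv i j (x, s)) (at (x, s))"
    by (rule smooth_on_has_derivative[OF smooth_flow[OF ij] z])
  have "((\<lambda>t. flow i j (x, t)) has_derivative (\<lambda>t. flow_deriv i j (x, s) (0, t))) (at s)"
    by (rule has_derivative_slice_right[OF D])
  then have "differential real_line M (\<lambda>t. P t (chart_inv S i x)) () j s = (\<lambda>t. flow_deriv i j (x, s) (0, t))"
    by (intro differential_eqI) (simp add: flow_def comp_def)
  moreover have "flow_deriv i j (x, s) (0, t) = t *\<^sub>R flow_normal i j (x, s)" for t
    using linear_cmul[OF has_derivative_linear[OF D], of t "(0, 1)"] by (simp add: flow_normal_def)
  ultimately show *: "differential real_line M (\<lambda>t. P t (chart_inv S i x)) () j s t = t *\<^sub>R flow_normal i j (x, s)"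
    for t by simp
  show "V s (chart_inv S i x) j = flow_normal i j (x, s)"
    by (simp add: parallel_normal_def velocity_def *)
qed

lemma graph_map_local:
  assumes ij: "i \<in> charts S" "j \<in> charts M" and y: "y \<in> flow_dom i j"
  shows "(chart_map MR (j, ()) \<circ> F \<circ> chart_inv SR (i, ())) y = (flow i j y, a (snd y))"
  using y by (auto simp: flow_dom_def flow_def graph_map_def chart_inv_product_real_line[OF atlas(1) ij(1)])

lemma graph_normal_local:
  assumes ij: "i \<in> charts S" "j \<in> charts M" and y: "y \<in> flow_dom i j"
  shows "N (chart_inv SR (i, ()) y) (j, ()) = (profile a (snd y) *\<^sub>R (- flow_normal i j y), graph_angle a (snd y))"
proof -
  obtain x t where xt: "y = (x, t)" by (cases y)
  have "chart_inv SR (i, ()) (x, t) = (chart_inv S i x, t)"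
    using y by (auto simp: xt flow_dom_def chart_inv_product_real_line[OF atlas(1) ij(1)])
  then show ?thesis
    using velocity_flow(2)[OF ij, of x t] y
    by (simp add: xt graph_normal_def profile_def graph_angle_def)
qed

lemma flow_dom_open: "i \<in> charts S \<Longrightarrow> j \<in> charts M \<Longrightarrow> open (flow_dom i j)"
  by (rule smooth_onD(1)[OF smooth_flow])

section \<open>Computation at a single point (p, s) in fixed charts\<close>

context
  fixes i j p s
  assumes ij: "i \<in> charts S" "j \<in> charts M" and p: "p \<in> chart_dom S i" and s: "s \<in> I"
    and Pp: "P s p \<in> chart_dom M j"
begin

abbreviation "z \<equiv> (chart_map S i p, s)"

lemma z: "z \<in> flow_dom i j"
  using ij p s Pp chart_inv_chart_map[OF atlas(1) ij(1)] by (auto simp: flow_dom_def)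

lemma inv_p: "chart_inv S i (chart_map S i p) = p"
  by (rule chart_inv_chart_map[OF atlas(1) ij(1) p])

lemma p_points: "p \<in> points S" using chart_dom_points ij p by blast

lemmas flow_has_derivative = smooth_on_has_derivative[OF smooth_flow[OF ij] z]
lemmas normal_has_derivative = smooth_on_has_derivative[OF smooth_flow_normal[OF ij] z]

abbreviation "L \<equiv> \<lambda>u. flow_deriv i j z (u, 0)"
abbreviation "\<nu> \<equiv> flow_normal i j z"
abbreviation "\<nu>' \<equiv> frechet_derivative (flow_normal i j) (at z)"
abbreviation "\<Gamma> \<equiv> christoffel M j (P s p)"

lemma V_eq: "V s p j = \<nu>"
  using velocity_flow(2)[OF ij z] by (simp add: inv_p)

lemma slice_open: "open ((\<lambda>x. (x, s)) -` flow_dom i j)" "chart_map S i p \<in> (\<lambda>x. (x, s)) -` flow_dom i j"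
  using z flow_dom_open[OF ij]
  by (auto intro!: open_vimage continuous_intros)

lemma differential_slice: "differential S M (P s) i j p = L"
  by (rule differential_eqI) (use has_derivative_slice_left[OF flow_has_derivative] in \<open>simp add: flow_def comp_def\<close>)

lemma covariant_derivative_slice:
  "covariant_derivative S M (P s) (V s) i j p u = \<nu>' (u, 0) + \<Gamma> (L u) \<nu>"
proof -
  have "((\<lambda>x. V s (chart_inv S i x) j) has_derivative (\<lambda>u. \<nu>' (u, 0))) (at (chart_map S i p))"
    by (rule has_derivative_transform_within_open[OF has_derivative_slice_left[OF normal_has_derivative] slice_open])
       (simp add: velocity_flow(2)[OF ij])
  then show ?thesis
    by (simp add: covariant_derivative_def frechet_derivative_eqI differential_slice V_eq)
qed

text \<open>Along the curve t |-> f_t(p) the velocity is the flow normal, so its acceleration is the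
  partial derivative of the flow normal in s plus the Christoffel term.\<close>

lemma geodesic_equation: "\<nu>' (0, 1) + \<Gamma> \<nu> \<nu> = 0"
proof -
  let ?\<gamma> = "\<lambda>t. P t p"
  have o: "open ((\<lambda>t. (chart_map S i p, t)) -` flow_dom i j)"
    using flow_dom_open[OF ij] by (auto intro!: open_vimage continuous_intros)
  have "((\<lambda>t. flow_normal i j (chart_map S i p, t)) has_derivative (\<lambda>t. \<nu>' (0, t))) (at s)"
    by (rule has_derivative_slice_right[OF normal_has_derivative])
  then have "((\<lambda>t. velocity M ?\<gamma> t j) has_derivative (\<lambda>t. \<nu>' (0, t))) (at s)"
  proof (rule has_derivative_transform_within_open[OF _ o])
    show "flow_normal i j (chart_map S i p, t) = velocity M ?\<gamma> t j"
      if "t \<in> (\<lambda>t. (chart_map S i p, t)) -` flow_dom i j" for t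
      using velocity_flow(2)[OF ij, of "chart_map S i p" t] that by (simp add: inv_p parallel_normal_def)
  qed (use z in simp)
  moreover have "covariant_dt M ?\<gamma> (velocity M ?\<gamma>) s j = 0"
    using geodesic[OF p_points] ij(2) s Pp unfolding geodesic_def by blast
  ultimately show ?thesis
    using velocity_flow(1)[OF ij z, of 1] V_eq
    by (simp add: covariant_dt_def covariant_derivative_def frechet_derivative_eqI inv_p
        parallel_normal_def)
qed

lemma deriv_decompose:
  assumes "(h has_derivative h') (at y)"
  shows "h' (u, t) = h' (u, 0) + t *\<^sub>R h' (0, 1::real)"
  using linear_add[OF has_derivative_linear[OF assms], of "(u, 0)" "t *\<^sub>R (0, 1)"]
    linear_cmul[OF has_derivative_linear[OF assms], of t "(0, 1)"] by simp

lemma real_compose_snd_has_derivative: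
  "smooth_on I h \<Longrightarrow> ((\<lambda>y. h (snd y)) has_derivative (\<lambda>y. deriv h s * snd y)) (at z)"
  using has_derivative_compose_snd[of h "(*) (deriv h s)" s] smooth_on_has_real_derivative[of I h s] s
  by (simp add: has_field_derivative_def)

lemma differential_graph:
  "differential SR MR F (i, ()) (j, ()) (p, s) (u, t) = (L u + t *\<^sub>R \<nu>, deriv a s * t)"
proof -
  have "((chart_map MR (j, ()) \<circ> F \<circ> chart_inv SR (i, ())) has_derivative
      (\<lambda>y. (flow_deriv i j z y, deriv a s * snd y))) (at z)"
    by (rule has_derivative_transform_within_open[OF has_derivative_Pair[OF flow_has_derivative
        real_compose_snd_has_derivative[OF a]] flow_dom_open[OF ij] z]) (simp only: graph_map_local[OF ij])
  then have "differential SR MR F (i, ()) (j, ()) (p, s) = (\<lambda>y. (flow_deriv i j z y, deriv a s * snd y))"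
    by (intro differential_eqI) simp
  then show ?thesis
    using deriv_decompose[OF flow_has_derivative, of u t] by (simp add: flow_normal_def)
qed

lemma graph_normal_at: "N (p, s) (j, ()) = (profile a s *\<^sub>R (- \<nu>), graph_angle a s)"
  by (simp add: graph_normal_def V_eq profile_def graph_angle_def)

text \<open>Differentiate N = (-\<rho> \<nu>, \<Theta>). The u terms assemble to -\<rho> times the
  covariant derivative on the slice. Among the t terms, \<open>\<nu>' (0, 1)\<close> and
  \<open>\<Gamma> \<nu> \<nu>\<close> cancel by the geodesic equation, and the vertical part is the
  derivative of \<Theta>.\<close>

lemma covariant_derivative_graph:
  "covariant_derivative SR MR F N (i, ()) (j, ()) (p, s) (u, t)
    = - (profile a s *\<^sub>R covariant_derivative S M (P s) (V s) i j p u + (t * deriv (profile a) s) *\<^sub>R \<nu>,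
       deriv a s * deriv (profile a) s * t)"
proof -
  have "((\<lambda>y. N (chart_inv SR (i, ()) y) (j, ())) has_derivative
      (\<lambda>y. (profile a s *\<^sub>R (- \<nu>' y) + (deriv (profile a) s * snd y) *\<^sub>R (- \<nu>), deriv (graph_angle a) s * snd y))) (at z)"
  proof (rule has_derivative_transform_within_open[OF _ flow_dom_open[OF ij] z])
    show "((\<lambda>y. (profile a (snd y) *\<^sub>R (- flow_normal i j y), graph_angle a (snd y))) has_derivative
      (\<lambda>y. (profile a s *\<^sub>R (- \<nu>' y) + (deriv (profile a) s * snd y) *\<^sub>R (- \<nu>), deriv (graph_angle a) s * snd y))) (at z)"
      using has_derivative_Pair[OF has_derivative_scaleR[OF
        real_compose_snd_has_derivative[OF smooth_on_profile[OF a]] has_derivative_minus[OF normal_has_derivative]]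
        real_compose_snd_has_derivative[OF smooth_on_graph_angle[OF a]]] by simp
  qed (simp only: graph_normal_local[OF ij])
  then have D: "frechet_derivative (\<lambda>y. N (chart_inv SR (i, ()) y) (j, ())) (at (chart_map SR (i, ()) (p, s))) (u, t)
     = (profile a s *\<^sub>R (- \<nu>' (u, t)) + (deriv (profile a) s * t) *\<^sub>R (- \<nu>), deriv (graph_angle a) s * t)"
    by (simp add: frechet_derivative_eqI)
  have \<Gamma>: "bilinear \<Gamma>"
    using levi_civita_christoffel[OF M ij(2) Pp] by (simp add: levi_civita_symbol_def)
  have "christoffel MR (j, ()) (F (p, s)) (differential SR MR F (i, ()) (j, ()) (p, s) (u, t)) (N (p, s) (j, ()))
     = (\<Gamma> (L u + t *\<^sub>R \<nu>) (profile a s *\<^sub>R (- \<nu>)), 0)"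
    unfolding differential_graph graph_normal_at
    by (simp add: graph_map_def christoffel_product_real_line[OF M ij(2) Pp])
  also have "\<Gamma> (L u + t *\<^sub>R \<nu>) (profile a s *\<^sub>R (- \<nu>)) = - profile a s *\<^sub>R (\<Gamma> (L u) \<nu> + t *\<^sub>R \<Gamma> \<nu> \<nu>)"
    by (simp add: bilinear_ladd[OF \<Gamma>] bilinear_lmul[OF \<Gamma>] bilinear_rmul[OF \<Gamma>] bilinear_rneg[OF \<Gamma>])
  finally have C: "christoffel MR (j, ()) (F (p, s)) (differential SR MR F (i, ()) (j, ()) (p, s) (u, t)) (N (p, s) (j, ()))
     = (- profile a s *\<^sub>R (\<Gamma> (L u) \<nu> + t *\<^sub>R \<Gamma> \<nu> \<nu>), 0)" .
  have \<nu>': "\<nu>' (0, 1) = - \<Gamma> \<nu> \<nu>"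
    using geodesic_equation by (simp add: eq_neg_iff_add_eq_0)
  show ?thesis
    unfolding covariant_derivative_def[of SR] D C covariant_derivative_slice
      deriv_decompose[OF normal_has_derivative, of u t] \<nu>' deriv_graph_angle[OF a s]
    by (simp add: algebra_simps)
qed

lemma inj_L: "inj L"
  using immersion_P[OF s] ij p p_points Pp differential_slice unfolding immersion_def by metis

lemma linear_L: "linear L"
  using has_derivative_linear[OF has_derivative_slice_left[OF flow_has_derivative]] .

text \<open>The vertical component determines t because a' is positive; what remains is injectivity
  of the differential of f_s.\<close>

lemma inj_differential_graph: "inj (differential SR MR F (i, ()) (j, ()) (p, s))"
proof (rule injI)
  fix y y' assume eq: "differential SR MR F (i, ()) (j, ()) (p, s) y = differential SR MR F (i, ()) (j, ()) (p, s) y'"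
  obtain u t u' t' where y: "y = (u, t)" "y' = (u', t')" by (cases y, cases y')
  from eq have "deriv a s * t = deriv a s * t'" and L: "L u + t *\<^sub>R \<nu> = L u' + t' *\<^sub>R \<nu>"
    unfolding y differential_graph by simp_all
  then have t: "t = t'" using a_pos[OF s] by simp
  with L have "L u = L u'" by simp
  then have "u = u'" by (rule injD[OF inj_L])
  with t show "y = y'" by (simp add: y)
qed

lemma endo_trace_shape_operator_graph:
  assumes hyp: "oriented_hypersurface S M (points S) (P s) (V s)"
  shows "endo_trace (shape_operator SR MR F N (i, ()) (j, ()) (p, s))
    = deriv (profile a) s - profile a s * endo_trace (shape_operator S M (P s) (V s) i j p)"
proof -
  let ?A = "shape_operator S M (P s) (V s) i j p"
  \<comment> \<open>The orientation hypothesis enters here: it guarantees a preimage, so the slice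
    shape operator satisfies its defining equation.\<close>
  have A: "L (?A u) = - covariant_derivative S M (P s) (V s) i j p u" for u
  proof -
    obtain w where w: "differential S M (P s) i j p w = - covariant_derivative S M (P s) (V s) i j p u"
      using shape_operator_exists[OF atlas(1) M hyp ij p_points p Pp] by blast
    then have "?A u = w" by (intro shape_operator_eqI) (simp_all only: differential_slice inj_L)
    with w show ?thesis by (simp add: differential_slice)
  qed
  \<comment> \<open>The t part of minus the covariant derivative is t \<rho>' (\<nu>, a'), the image
    of (0, \<rho>' t); the u part is horizontal and the image of (-\<rho> A u, 0). The preimage is
    thus visible, and no orientation of the graph is required.\<close>
  have "shape_operator SR MR F N (i, ()) (j, ()) (p, s) (u, t) = (- profile a s *\<^sub>R ?A u, deriv (profile a) s * t)" for u t
  proof (rule shape_operator_eqI[OF inj_differential_graph])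
    have "L (- profile a s *\<^sub>R ?A u) = profile a s *\<^sub>R covariant_derivative S M (P s) (V s) i j p u"
      unfolding linear_cmul[OF linear_L] A by simp
    then show "differential SR MR F (i, ()) (j, ()) (p, s) (- profile a s *\<^sub>R ?A u, deriv (profile a) s * t)
      = - covariant_derivative SR MR F N (i, ()) (j, ()) (p, s) (u, t)"
      unfolding differential_graph covariant_derivative_graph by (simp add: mult_ac)
  qed
  then have "endo_trace (shape_operator SR MR F N (i, ()) (j, ()) (p, s))
      = endo_trace (\<lambda>u. - profile a s *\<^sub>R ?A u) + deriv (profile a) s"
    by (rule endo_trace_prod)
  then show ?thesis unfolding endo_trace_scaleR by simp
qed

end

end

section \<open>Global statements: orienting the graph from its slices and the slices from the
  graph\<close>

context parallel_graph
begin

lemma graph_dom_eq: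
  assumes "i \<in> charts S"
  shows "chart_map SR (i, ()) ` ((points S \<times> I) \<inter> chart_dom SR (i, ()) \<inter> F -` chart_dom MR (j, ()))
    = flow_dom i j"
proof -
  have "F -` chart_dom MR (j, ()) = (\<lambda>(p, s). P s p) -` chart_dom M j"
    by (auto simp: graph_map_def)
  then show ?thesis using flow_dom_eq[OF assms] by simp
qed

lemma smooth_on_compose_snd:
  fixes h :: "real \<Rightarrow> 'b::real_normed_vector"
  assumes "smooth_on I h" "i \<in> charts S" "j \<in> charts M"
  shows "smooth_on (flow_dom i j) (\<lambda>y. h (snd y))"
proof (rule smooth_on_compose[OF _ assms(1)])
  show "smooth_on (flow_dom i j) snd"
    using smooth_on_bounded_linear[OF bounded_linear_snd smooth_on_ident[OF flow_dom_open[OF assms(2,3)]]] .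
qed (auto simp: flow_dom_def)

lemma smooth_graph: "smooth_map SR MR (points S \<times> I) F"
  unfolding smooth_map_def
proof (intro conjI ballI)
  show "open (points S \<times> I)" "points S \<times> I \<subseteq> points SR"
    using smooth_P by (auto simp: smooth_map_def)
  show "F ` (points S \<times> I) \<subseteq> points MR"
    using smooth_P by (auto simp: smooth_map_def graph_map_def)
  have "continuous_on (points S \<times> I) (\<lambda>y. (case y of (p, s) \<Rightarrow> P s p, a (snd y)))"
    using smooth_P
    by (intro continuous_on_Pair continuous_on_compose2[OF smooth_on_imp_continuous_on[OF a]])
      (auto simp: smooth_map_def intro!: continuous_intros)
  then show "continuous_on (points S \<times> I) F" by (simp add: graph_map_def case_prod_beta')
  fix i' j' assume "i' \<in> charts SR" "j' \<in> charts MR"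
  then obtain i j where ij: "i' = (i, ())" "j' = (j, ())" "i \<in> charts S" "j \<in> charts M" by auto
  have "smooth_on (flow_dom i j) (chart_map MR (j, ()) \<circ> F \<circ> chart_inv SR (i, ()))"
    by (rule smooth_on_cong[OF smooth_on_Pair[OF smooth_flow[OF ij(3,4)] smooth_on_compose_snd[OF a ij(3,4)]]])
       (simp only: graph_map_local[OF ij(3,4)])
  then show "smooth_on (chart_map SR i' ` ((points S \<times> I) \<inter> chart_dom SR i' \<inter> F -` chart_dom MR j'))
      (chart_map MR j' \<circ> F \<circ> chart_inv SR i')"
    unfolding ij graph_dom_eq[OF ij(3)] .
qed

lemma smooth_graph_normal:
  assumes "i \<in> charts S" "j \<in> charts M"
  shows "smooth_on (flow_dom i j) (\<lambda>y. N (chart_inv SR (i, ()) y) (j, ()))"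
proof (rule smooth_on_cong)
  show "smooth_on (flow_dom i j) (\<lambda>y. (profile a (snd y) *\<^sub>R (- flow_normal i j y), graph_angle a (snd y)))"
    by (intro smooth_on_Pair smooth_on_scaleR smooth_on_compose_snd[OF _ assms] smooth_on_profile
        smooth_on_graph_angle a smooth_on_bounded_linear[OF bounded_linear_minus[OF bounded_linear_ident]]
        smooth_flow_normal[OF assms])
qed (simp only: graph_normal_local[OF assms])

lemma tangent_vector_graph_normal:
  assumes "s \<in> I"
  shows "tangent_vector MR (F (p, s)) (N (p, s)) \<longleftrightarrow> tangent_vector M (P s p) (V s p)"
proof -
  have "1 / sqrt (1 + (deriv a s)\<^sup>2) \<noteq> 0"
    using graph_angle_pos[of a s] by (simp add: graph_angle_def)
  moreover have "- deriv a s \<noteq> 0" using a_pos[OF assms] by simp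
  ultimately show ?thesis
    using tangent_vector_product_real_line[OF atlas(2), of "1 / sqrt (1 + (deriv a s)\<^sup>2)" "- deriv a s"
      "N (p, s)" "V s p" "P s p" "a s"] by (simp add: graph_normal_def graph_map_def)
qed

text \<open>Neither unit length nor orthogonality of \<eta>_s is assumed, so the same identities
  serve both directions of the transfer. The last term of the second one combines the vertical
  contribution a' t \<Theta> = \<rho> t with the horizontal -\<rho> t |\<eta>_s|^2.\<close>

lemma metric_graph:
  assumes "i \<in> charts S" "j \<in> charts M" "p \<in> chart_dom S i" "s \<in> I" "P s p \<in> chart_dom M j"
  shows "metric_at MR (j, ()) (F (p, s)) (N (p, s) (j, ())) (N (p, s) (j, ()))
      = (profile a s)\<^sup>2 * metric_at M j (P s p) (V s p j) (V s p j) + (graph_angle a s)\<^sup>2"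
    and "metric_at MR (j, ()) (F (p, s)) (differential SR MR F (i, ()) (j, ()) (p, s) (u, t)) (N (p, s) (j, ()))
      = - profile a s * metric_at M j (P s p) (differential S M (P s) i j p u) (V s p j)
        + profile a s * t * (1 - metric_at M j (P s p) (V s p j) (V s p j))"
proof -
  note g = riemannian_manifoldD(2)[OF M assms(2,5)]
  show "metric_at MR (j, ()) (F (p, s)) (N (p, s) (j, ())) (N (p, s) (j, ()))
      = (profile a s)\<^sup>2 * metric_at M j (P s p) (V s p j) (V s p j) + (graph_angle a s)\<^sup>2"
    unfolding graph_normal_at[OF assms] V_eq[OF assms]
    by (simp add: graph_map_def bilinear_lmul[OF g] bilinear_rmul[OF g] bilinear_lneg[OF g]
        bilinear_rneg[OF g] power2_eq_square)
  show "metric_at MR (j, ()) (F (p, s)) (differential SR MR F (i, ()) (j, ()) (p, s) (u, t)) (N (p, s) (j, ()))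
      = - profile a s * metric_at M j (P s p) (differential S M (P s) i j p u) (V s p j)
        + profile a s * t * (1 - metric_at M j (P s p) (V s p j) (V s p j))"
    unfolding graph_normal_at[OF assms] V_eq[OF assms] differential_graph[OF assms] differential_slice[OF assms]
    by (simp add: graph_map_def bilinear_lmul[OF g] bilinear_rmul[OF g] bilinear_rneg[OF g]
        bilinear_ladd[OF g]) (simp add: profile_def algebra_simps)
qed

lemma oriented_graph:
  assumes "\<And>s. s \<in> I \<Longrightarrow> oriented_hypersurface S M (points S) (P s) (V s)"
  shows "oriented_hypersurface SR MR (points S \<times> I) F N"
  unfolding oriented_hypersurface_def
proof (intro conjI ballI impI allI)
  show "DIM('d \<times> real) + 1 = DIM('e \<times> real)" using dim by simp
  show "immersion SR MR (points S \<times> I) F"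
    using smooth_graph inj_differential_graph by (auto simp: immersion_def graph_map_def)
  show "vector_field_along SR MR (points S \<times> I) F N"
    unfolding vector_field_along_def
  proof (intro conjI ballI)
    show "tangent_vector MR (F y) (N y)" if "y \<in> points S \<times> I" for y
      using assms that tangent_vector_graph_normal
      by (cases y) (auto simp: oriented_hypersurface_def vector_field_along_def)
    fix i' j' assume "i' \<in> charts SR" "j' \<in> charts MR"
    then obtain i j where ij: "i' = (i, ())" "j' = (j, ())" "i \<in> charts S" "j \<in> charts M" by auto
    show "smooth_on (chart_map SR i' ` ((points S \<times> I) \<inter> chart_dom SR i' \<inter> F -` chart_dom MR j'))
      (\<lambda>x. N (chart_inv SR i' x) j')"
      unfolding ij graph_dom_eq[OF ij(3)] by (rule smooth_graph_normal[OF ij(3,4)])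
  qed
  fix y i' j' assume y: "y \<in> points S \<times> I" and "i' \<in> charts SR" "j' \<in> charts MR"
    "y \<in> chart_dom SR i'" "F y \<in> chart_dom MR j'"
  then obtain i j p s where ij: "i' = (i, ())" "j' = (j, ())" "y = (p, s)"
      and *: "i \<in> charts S" "j \<in> charts M" "p \<in> chart_dom S i" "s \<in> I" "P s p \<in> chart_dom M j"
    by (auto simp: graph_map_def)
  have unit: "metric_at M j (P s p) (V s p j) (V s p j) = 1"
    and orth: "metric_at M j (P s p) (differential S M (P s) i j p u) (V s p j) = 0" for u
    using assms[OF *(4)] * p_points[OF *] unfolding oriented_hypersurface_def by blast+
  show "metric_at MR j' (F y) (N y j') (N y j') = 1"
    using graph_angle_profile_squares[of a s] unfolding ij metric_graph[OF *] unit by simp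
  show "metric_at MR j' (F y) (differential SR MR F i' j' y w) (N y j') = 0" for w
    by (cases w) (simp add: ij metric_graph(2)[OF *] unit orth del: riemannian_product_simps)
qed

text \<open>The Gauss lemma, \<open>\<eta>\<^sub>s \<bottom> df\<^sub>s\<close>, comes for free here: it is the horizontal part of the
  orthogonality of \<open>N\<close> to the graph.\<close>

lemma oriented_slice:
  assumes hyp: "oriented_hypersurface SR MR (points S \<times> I) F N" and s: "s \<in> I"
  shows "oriented_hypersurface S M (points S) (P s) (V s)"
  unfolding oriented_hypersurface_def
proof (intro conjI ballI impI allI)
  show "DIM('d) + 1 = DIM('e)" by (rule dim)
  show "immersion S M (points S) (P s)" by (rule immersion_P[OF s])
  show "vector_field_along S M (points S) (P s) (V s)"
    unfolding vector_field_along_def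
  proof (intro conjI ballI)
    show "tangent_vector M (P s p) (V s p)" if "p \<in> points S" for p
      using hyp that s tangent_vector_graph_normal[OF s, of p]
      by (auto simp: oriented_hypersurface_def vector_field_along_def)
    fix i j assume ij: "i \<in> charts S" "j \<in> charts M"
    have o: "open ((\<lambda>x. (x, s)) -` flow_dom i j)"
      using flow_dom_open[OF ij] by (auto intro!: open_vimage continuous_intros)
    have "smooth_on ((\<lambda>x. (x, s)) -` flow_dom i j) (\<lambda>x. flow_normal i j (x, s))"
      by (rule smooth_on_compose[OF smooth_on_Pair[OF smooth_on_ident smooth_on_const] smooth_flow_normal[OF ij]])
        (auto simp: o)
    then show "smooth_on (chart_map S i ` (points S \<inter> chart_dom S i \<inter> P s -` chart_dom M j))
        (\<lambda>x. V s (chart_inv S i x) j)"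
      unfolding slice_dom[OF ij(1) s] by (rule smooth_on_cong) (simp add: velocity_flow(2)[OF ij])
  qed
  fix p i j assume p: "p \<in> points S" and *: "i \<in> charts S" "j \<in> charts M" "p \<in> chart_dom S i" "P s p \<in> chart_dom M j"
  note A = *(1-3) s *(4)
  have unit: "metric_at MR (j, ()) (F (p, s)) (N (p, s) (j, ())) (N (p, s) (j, ())) = 1"
    and orth: "metric_at MR (j, ()) (F (p, s)) (differential SR MR F (i, ()) (j, ()) (p, s) w) (N (p, s) (j, ())) = 0" for w
  proof -
    have "(p, s) \<in> points S \<times> I" "(i, ()) \<in> charts SR" "(j, ()) \<in> charts MR"
      "(p, s) \<in> chart_dom SR (i, ())" "F (p, s) \<in> chart_dom MR (j, ())"
      using p A by (auto simp: graph_map_def)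
    then show "metric_at MR (j, ()) (F (p, s)) (N (p, s) (j, ())) (N (p, s) (j, ())) = 1"
      "metric_at MR (j, ()) (F (p, s)) (differential SR MR F (i, ()) (j, ()) (p, s) w) (N (p, s) (j, ())) = 0"
      using hyp unfolding oriented_hypersurface_def by blast+
  qed
  have pos: "profile a s > 0" using profile_bounds[OF a_pos[OF s]] by blast
  \<comment> \<open>Unit length of N compared with \<rho>^2 + \<Theta>^2 = 1; then \<rho>^2
    cancels.\<close>
  have "(profile a s)\<^sup>2 * metric_at M j (P s p) (V s p j) (V s p j) = (profile a s)\<^sup>2 * 1"
    using unit graph_angle_profile_squares[of a s] unfolding metric_graph(1)[OF A] by linarith
  then show u: "metric_at M j (P s p) (V s p j) (V s p j) = 1" using pos by simp
  show "metric_at M j (P s p) (differential S M (P s) i j p u) (V s p j) = 0" for u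
    using orth[of "(u, 0)"] pos unfolding metric_graph(2)[OF A] by simp
qed

text \<open>Solving \<rho>' - \<rho> h = H for the slice curvature h, which is possible since \<rho>
  > 0, yields an expression in s alone. That is why constancy on the graph amounts to constancy on
  each slice.\<close>

lemma constant_mean_curvature_graph_iff:
  assumes "\<And>s. s \<in> I \<Longrightarrow> oriented_hypersurface S M (points S) (P s) (V s)"
  shows "graph_has_constant_mean_curvature S M f \<eta> I a H \<longleftrightarrow>
    isoparametric S M f \<eta> I (\<lambda>s. (deriv (profile a) s - H) / profile a s)"
proof -
  have eq: "endo_trace (shape_operator SR MR F N (i, ()) (j, ()) (p, s)) = H \<longleftrightarrow>
     endo_trace (shape_operator S M (P s) (V s) i j p) = (deriv (profile a) s - H) / profile a s"
    if "i \<in> charts S" "j \<in> charts M" "p \<in> chart_dom S i" "s \<in> I" "P s p \<in> chart_dom M j" for i j p s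
    unfolding endo_trace_shape_operator_graph[OF that assms[OF that(4)]]
    using profile_bounds[OF a_pos[OF that(4)]] by (auto simp: field_simps)
  show ?thesis
  proof
    assume G: "graph_has_constant_mean_curvature S M f \<eta> I a H"
    show "isoparametric S M f \<eta> I (\<lambda>s. (deriv (profile a) s - H) / profile a s)"
      unfolding isoparametric_def constant_mean_curvature_def
    proof (intro ballI conjI impI assms)
      fix s p i j
      assume s: "s \<in> I" and p: "p \<in> points S"
        and *: "i \<in> charts S" "j \<in> charts M" "p \<in> chart_dom S i" "P s p \<in> chart_dom M j"
      then have "(p, s) \<in> points S \<times> I" "(i, ()) \<in> charts SR" "(j, ()) \<in> charts MR"
        "(p, s) \<in> chart_dom SR (i, ())" "F (p, s) \<in> chart_dom MR (j, ())"
        by (auto simp: graph_map_def)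
      then have "endo_trace (shape_operator SR MR F N (i, ()) (j, ()) (p, s)) = H"
        using G unfolding graph_has_constant_mean_curvature_def constant_mean_curvature_def by blast
      then show "endo_trace (shape_operator S M (P s) (V s) i j p) = (deriv (profile a) s - H) / profile a s"
        using eq[OF *(1-3) s *(4)] by blast
    qed
  next
    assume iso: "isoparametric S M f \<eta> I (\<lambda>s. (deriv (profile a) s - H) / profile a s)"
    show "graph_has_constant_mean_curvature S M f \<eta> I a H"
      unfolding graph_has_constant_mean_curvature_def constant_mean_curvature_def
    proof (intro ballI conjI impI oriented_graph assms)
      fix y i' j' assume "y \<in> points S \<times> I" "i' \<in> charts SR" "j' \<in> charts MR"
        "y \<in> chart_dom SR i'" "F y \<in> chart_dom MR j'"
      then obtain i j p s where ij: "i' = (i, ())" "j' = (j, ())" "y = (p, s)"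
          and *: "i \<in> charts S" "j \<in> charts M" "p \<in> chart_dom S i" "s \<in> I" "P s p \<in> chart_dom M j"
        by (auto simp: graph_map_def)
      have "endo_trace (shape_operator S M (P s) (V s) i j p) = (deriv (profile a) s - H) / profile a s"
        using iso * p_points[OF *] unfolding isoparametric_def constant_mean_curvature_def by blast
      then show "endo_trace (shape_operator SR MR F N i' j' y) = H"
        using eq[OF *] by (simp only: ij)
    qed
  qed
qed

end

theorem theorem7:
  fixes M :: "('j, 'm::{t2_space, second_countable_topology}, 'e::euclidean_space) riemannian"
    and S :: "('i, 's::{t2_space, second_countable_topology}, 'd::euclidean_space) riemannian"
    and f :: "'s \<Rightarrow> 'm" and \<eta> :: "'s \<Rightarrow> 'j \<Rightarrow> 'e"
    and I :: "real set" and a :: "real \<Rightarrow> real" and H :: real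
  assumes "DIM('e) \<ge> 2"
    and "fs_a_graph S M f \<eta> I a"
  shows
    "(\<forall>Hs \<rho> s0.
        isoparametric S M f \<eta> I Hs \<longrightarrow> profile_solution I Hs H \<rho> \<longrightarrow> s0 \<in> I \<longrightarrow>
        (\<forall>s\<in>I. a s = (LBINT u=ereal s0..ereal s. \<rho> u / sqrt (1 - (\<rho> u)\<^sup>2))) \<longrightarrow>
        graph_has_constant_mean_curvature S M f \<eta> I a H)
     \<and>
     (graph_has_constant_mean_curvature S M f \<eta> I a H \<longrightarrow>
        (\<exists>Hs. isoparametric S M f \<eta> I Hs \<and>
           (let \<rho> = (\<lambda>s. deriv a s * graph_angle a s) in
              profile_solution I Hs H \<rho> \<and>
              (\<forall>s0\<in>I. \<forall>s\<in>I.
                 a s - a s0 = (LBINT u=ereal s0..ereal s. \<rho> u / sqrt (1 - (\<rho> u)\<^sup>2))))))"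
proof -
  interpret parallel_graph M S f \<eta> I a by standard (rule assms(2))
  show ?thesis
  proof (intro conjI allI impI)
    fix Hs \<rho> s0
    assume iso: "isoparametric S M f \<eta> I Hs" and sol: "profile_solution I Hs H \<rho>" and s0: "s0 \<in> I"
      and int: "\<forall>s\<in>I. a s = (LBINT u=ereal s0..ereal s. \<rho> u / sqrt (1 - (\<rho> u)\<^sup>2))"
    have bounds: "0 < \<rho> s" "\<rho> s < 1" and D: "(\<rho> has_real_derivative Hs s * \<rho> s + H) (at s)" if "s \<in> I" for s
      using sol that by (auto simp: profile_solution_def)
    have sq: "(\<rho> s)\<^sup>2 < 1" if "s \<in> I" for s
      using bounds[OF that] by (simp add: power_less_one_iff)
    have "continuous_on I \<rho>" by (rule DERIV_continuous_on[OF has_field_derivative_at_within[OF D]])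
    \<comment> \<open>The bound \<rho> < 1 keeps the denominator away from zero at every point, as
      the fundamental theorem of calculus needs a continuous integrand.\<close>
    then have c: "continuous_on I (\<lambda>u. \<rho> u / sqrt (1 - (\<rho> u)\<^sup>2))"
      by (intro continuous_on_divide continuous_on_real_sqrt continuous_on_diff continuous_on_const
          continuous_on_power ballI) (use sq in fastforce)+
    have prof: "profile a s = \<rho> s" if "s \<in> I" for s
    proof (rule profile_eqI[OF bounds[OF that]])
      show "deriv a s = \<rho> s / sqrt (1 - (\<rho> s)\<^sup>2)"
        by (rule deriv_eqI_interval_integral[OF I interval c s0 that]) (use int in blast)
    qed
    \<comment> \<open>The profile agrees with \<rho> on I only; openness of I carries the derivative
      over.\<close>
    have "(profile a has_real_derivative Hs s * \<rho> s + H) (at s)" if "s \<in> I" for s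
      by (rule has_field_derivative_transform_within_open[OF D[OF that] I that]) (simp add: prof)
    then have "deriv (profile a) s = Hs s * \<rho> s + H" if "s \<in> I" for s
      using that by (blast intro: DERIV_imp_deriv)
    \<comment> \<open>The differential equation solved for the curvature: the value demanded by the
      equivalence is the given \<open>Hs s\<close>.\<close>
    then have "(deriv (profile a) s - H) / profile a s = Hs s" if "s \<in> I" for s
      using bounds(1)[OF that] prof[OF that] that by simp
    with iso have "isoparametric S M f \<eta> I (\<lambda>s. (deriv (profile a) s - H) / profile a s)"
      by (simp add: isoparametric_def)
    moreover have "oriented_hypersurface S M (points S) (P s) (V s)" if "s \<in> I" for s
      using iso that by (simp add: isoparametric_def constant_mean_curvature_def)
    ultimately show "graph_has_constant_mean_curvature S M f \<eta> I a H"
      using constant_mean_curvature_graph_iff by blast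
  next
    assume H: "graph_has_constant_mean_curvature S M f \<eta> I a H"
    \<comment> \<open>The value forced by the differential equation, which consequently holds by
      construction; the content lies in showing that it is the mean curvature of the slices.\<close>
    let ?Hs = "\<lambda>s. (deriv (profile a) s - H) / profile a s"
    have "oriented_hypersurface SR MR (points S \<times> I) F N"
      using H by (simp add: graph_has_constant_mean_curvature_def constant_mean_curvature_def)
    with H have iso: "isoparametric S M f \<eta> I ?Hs"
      using constant_mean_curvature_graph_iff oriented_slice by blast
    have sol: "profile_solution I ?Hs H (profile a)"
      unfolding profile_solution_def
    proof (intro ballI conjI)
      fix s assume s: "s \<in> I"
      show b: "0 < profile a s" "profile a s < 1" using profile_bounds[OF a_pos[OF s]] by auto
      show "(profile a has_real_derivative ?Hs s * profile a s + H) (at s)"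
        using smooth_on_has_real_derivative[OF smooth_on_profile[OF a] s] b by simp
    qed
    have \<rho>: "(\<lambda>s. deriv a s * graph_angle a s) = profile a" by (simp add: fun_eq_iff profile_def)
    show "\<exists>Hs. isoparametric S M f \<eta> I Hs \<and>
           (let \<rho> = (\<lambda>s. deriv a s * graph_angle a s) in
              profile_solution I Hs H \<rho> \<and>
              (\<forall>s0\<in>I. \<forall>s\<in>I.
                 a s - a s0 = (LBINT u=ereal s0..ereal s. \<rho> u / sqrt (1 - (\<rho> u)\<^sup>2))))"
      \<comment> \<open>The integrand becomes the derivative of a, so the formula is the fundamental
        theorem of calculus for every base point in I.\<close>
      unfolding Let_def \<rho> profile_divide_sqrt
      by (intro exI[of _ ?Hs] conjI iso sol ballI interval_integral_deriv[OF a interval, symmetric])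
  qed
qed

end
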